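(* For every nonnegative integer $s$, the number $SH^3_3(s)$ of $3\times 3\times 3$ semi-magic cubes of magic sum $s$ is $$SH^3_3(s)=\begin{cases}\frac{9}{2240}s^8+\frac{27}{560}s^7+\frac{87}{320}s^6+\frac{297}{320}s^5+\frac{1341}{640}s^4+\frac{513}{160}s^3+\frac{3653}{1120}s^2+\frac{627}{280}s+1 & \text{if } 2\mid s,\\[4pt] \frac{9}{2240}s^8+\frac{27}{560}s^7+\frac{87}{320}s^6+\frac{297}{320}s^5+\frac{1341}{640}s^4+\frac{513}{160}s^3+\frac{3653}{1120}s^2+\frac{4071}{2240}s+\frac{47}{128} & \text{otherwise.}\end{cases}$$
   Context: A $3\times 3\times 3$ semi-magic cube of magic sum $s$ is a $3\times 3\times 3$ array of nonnegative integers (not required to be distinct) such that the entries along every line parallel to a coordinate axis sum to $s$. *)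

theory Defs
  imports "HOL-Analysis.Finite_Cartesian_Product"
begin

text \<open>
  The entry of the cube \<open>A\<close> at position \<open>(i, j, k)\<close> is \<open>A $ i $ j $ k\<close>. The three conjuncts
  concern the lines parallel to the third, second and first coordinate axis, respectively.
\<close>

definition semi_magic_cube :: "nat \<Rightarrow> nat ^ 'n ^ 'n ^ 'n \<Rightarrow> bool" where
  "semi_magic_cube s A \<longleftrightarrow>
     (\<forall>i j. (\<Sum>k\<in>UNIV. A $ i $ j $ k) = s) \<and>
     (\<forall>i k. (\<Sum>j\<in>UNIV. A $ i $ j $ k) = s) \<and>
     (\<forall>j k. (\<Sum>i\<in>UNIV. A $ i $ j $ k) = s)"

definition SH33 :: "nat \<Rightarrow> nat" where
  "SH33 s = card {A :: nat ^ 3 ^ 3 ^ 3. semi_magic_cube s A}"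

end

theory Submission
  imports Defs "HOL-Analysis.Cartesian_Space"
begin

text \<open>
  Each layer of a semi-magic cube is a combination \<open>a (k - j) + b (k + j)\<close> of the six permutation
  matrices of order 3, and the sums across layers say that the three rows \<open>a\<close>, and likewise the three
  rows \<open>b\<close>, form \<open>3 \<times> 3\<close> tables with constant column sums \<open>m\<close> and \<open>s - m\<close>. Normalising \<open>a\<close> to have
  a zero in each row, a cube is a pair of such tables with complementary row sums. Hence the number of
  cubes is the sum over all row sums \<open>q\<close> of \<open>T q * B (s - q)\<close>, where \<open>B\<close> counts all tables and
  \<open>T\<close> those with a zero in each row. Both are piecewise polynomial in the deviation of the row sums
  from \<open>m\<close>, a point of a hexagonal lattice; \<open>T\<close> depends only on the sector of that point and on the
  difference of \<open>m\<close> and its hexagonal norm \<open>D\<close>. The sum over a hexagon of norm \<open>D\<close> is a polynomial,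
  and the sum of these over \<open>D \<le> s div 2\<close> produces the dependence on the parity of \<open>s\<close>.
\<close>

section \<open>Compositions into three parts\<close>

text \<open>In a layer every sum of an \<open>a\<close>-entry and a \<open>b\<close>-entry occurs at
  exactly one position. So lines across the layers add a column of the \<open>a\<close>-table to a
  column of the \<open>b\<close>-table in every combination, which forces constant column sums,
  while a line inside a layer adds one full row of each table, which makes the row sums
  complementary. The only linear relation between the six matrices is that the three even and the
  three odd ones have the same sum, the all-ones matrix; one zero per \<open>a\<close>-row removes
  exactly this ambiguity.

  Two obstacles shape the computation. \<open>B\<close> is only piecewise a quartic, and
  \<open>T\<close> is an alternating sum of eight values of \<open>B\<close> whose shifts cross the
  walls, so the formulas for \<open>B\<close> are needed slightly beyond their own regions. Three
  differences lower the degree from 4 to 1, with an exceptional value where \<open>m = D\<close>.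
  Further, \<open>B\<close> changes its formula once \<open>D\<close> exceeds its column sum
  \<open>s - m\<close>; these outer rings are summed in another lattice direction, with an index
  that again runs up to \<open>s div 2\<close> but is no longer a norm.\<close>

definition comp3 :: "int \<Rightarrow> (int \<times> int \<times> int) set" where
  "comp3 r = {(x, y, z). 0 \<le> x \<and> 0 \<le> y \<and> 0 \<le> z \<and> x + y + z = r}"

definition ncomp3 :: "int \<Rightarrow> real" where
  "ncomp3 r = (if r < 0 then 0 else (of_int r + 1) * (of_int r + 2) / 2)"

text \<open>The zeros of the polynomial are -1 and -2, so it continues the count two steps into the
  empty range. The shifted terms of the later inclusion-exclusion use this slack.\<close>

lemma ncomp3_poly: "r \<ge> -2 \<Longrightarrow> ncomp3 r = (of_int r + 1) * (of_int r + 2) / 2"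
proof -
  assume "r \<ge> -2"
  then consider "r = -2" | "r = -1" | "r \<ge> 0" by linarith
  then show ?thesis by cases (auto simp: ncomp3_def)
qed

lemma ncomp3_neg: "r < 0 \<Longrightarrow> ncomp3 r = 0"
  by (simp add: ncomp3_def)

lemma finite_comp3: "finite (comp3 r)"
proof (rule finite_subset)
  show "comp3 r \<subseteq> {0..r} \<times> {0..r} \<times> {0..r}"
    by (auto simp: comp3_def)
qed auto

lemma sum_comp3_fst:
  fixes f :: "int \<Rightarrow> real"
  shows "(\<Sum>w\<in>comp3 r. f (fst w)) = (\<Sum>x\<in>{0..r}. of_int (r - x + 1) * f x)"
proof -
  have bij: "bij_betw (\<lambda>(x, y). (x, y, r - x - y)) (Sigma {0..r} (\<lambda>x. {0..r - x})) (comp3 r)"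
    by (rule bij_betwI[where g = "\<lambda>(x, y, z). (x, y)"]) (auto simp: comp3_def)
  have "(\<Sum>w\<in>comp3 r. f (fst w)) = (\<Sum>(x, y)\<in>Sigma {0..r} (\<lambda>x. {0..r - x}). f x)"
    by (subst sum.reindex_bij_betw[OF bij, symmetric]) (auto intro!: sum.cong)
  also have "\<dots> = (\<Sum>x\<in>{0..r}. \<Sum>y\<in>{0..r - x}. f x)"
    by (subst sum.Sigma) auto
  also have "\<dots> = (\<Sum>x\<in>{0..r}. of_int (r - x + 1) * f x)"
    by (rule sum.cong) auto
  finally show ?thesis .
qed

lemma sum_comp3_coord:
  fixes f :: "int \<Rightarrow> real"
  shows "(\<Sum>w\<in>comp3 r. f (fst (snd w))) = (\<Sum>w\<in>comp3 r. f (fst w))"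
    and "(\<Sum>w\<in>comp3 r. f (snd (snd w))) = (\<Sum>w\<in>comp3 r. f (fst w))"
proof -
  have bij1: "bij_betw (\<lambda>(x, y, z). (y, x, z)) (comp3 r) (comp3 r)"
    by (rule bij_betwI[where g = "\<lambda>(x, y, z). (y, x, z)"]) (auto simp: comp3_def)
  have bij2: "bij_betw (\<lambda>(x, y, z). (z, y, x)) (comp3 r) (comp3 r)"
    by (rule bij_betwI[where g = "\<lambda>(x, y, z). (z, y, x)"]) (auto simp: comp3_def)
  show "(\<Sum>w\<in>comp3 r. f (fst (snd w))) = (\<Sum>w\<in>comp3 r. f (fst w))"
    by (subst sum.reindex_bij_betw[OF bij1, symmetric]) (auto intro!: sum.cong)
  show "(\<Sum>w\<in>comp3 r. f (snd (snd w))) = (\<Sum>w\<in>comp3 r. f (fst w))"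
    by (subst sum.reindex_bij_betw[OF bij2, symmetric]) (auto intro!: sum.cong)
qed

lemma sum_int_nat:
  fixes f :: "int \<Rightarrow> real"
  shows "(\<Sum>x\<in>{0..int n}. f x) = (\<Sum>k\<le>n. f (int k))"
proof -
  have "bij_betw int {..n} {0..int n}"
    by (rule bij_betwI[where g = nat]) auto
  from sum.reindex_bij_betw[OF this, of f] show ?thesis by simp
qed

lemma card_comp3: "real (card (comp3 r)) = ncomp3 r"
proof (cases "r < 0")
  case True
  then have "comp3 r = {}" by (auto simp: comp3_def)
  with True show ?thesis by (simp add: ncomp3_def)
next
  case False
  then obtain n where r: "r = int n" by (metis nonneg_int_cases not_less)
  have "(\<Sum>k\<le>m. real n - real k + 1) = (real m + 1) * (2 * real n - real m + 2) / 2" for m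
    by (induction m) (auto simp: field_simps)
  then have "(\<Sum>k\<le>n. real n - real k + 1) = (real n + 1) * (real n + 2) / 2"
    by simp
  moreover have "real (card (comp3 r)) = (\<Sum>k\<le>n. real n - real k + 1)"
    using sum_comp3_fst[of "\<lambda>_. 1" r] by (simp add: r sum_int_nat)
  ultimately show ?thesis by (simp add: r ncomp3_def)
qed

text \<open>The hypotheses on pairs such as \<open>h1 + h2\<close> say that two coordinates never
  violate their bounds together, so inclusion-exclusion has no higher terms; one violation is
  removed by subtracting the bound from its coordinate.\<close>

lemma card_box_comp3:
  assumes h: "0 \<le> h1" "0 \<le> h2" "0 \<le> h3" "r < h1 + h2" "r < h1 + h3" "r < h2 + h3"
  shows "real (card {v \<in> comp3 r. fst v < h1 \<and> fst (snd v) < h2 \<and> snd (snd v) < h3})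
    = ncomp3 r - ncomp3 (r - h1) - ncomp3 (r - h2) - ncomp3 (r - h3)" (is "real (card ?B) = _")
proof -
  define A1 A2 A3 where A: "A1 = {v \<in> comp3 r. h1 \<le> fst v}"
    "A2 = {v \<in> comp3 r. h2 \<le> fst (snd v)}" "A3 = {v \<in> comp3 r. h3 \<le> snd (snd v)}"
  have fin: "finite ?B" "finite A1" "finite A2" "finite A3"
    by (auto intro: finite_subset[OF _ finite_comp3[of r]] simp: A)
  have "card (A2 \<union> A3) = card A2 + card A3"
    by (rule card_Un_disjoint) (use fin h in \<open>auto simp: A comp3_def\<close>)
  moreover have "card (A1 \<union> (A2 \<union> A3)) = card A1 + card (A2 \<union> A3)"
    by (rule card_Un_disjoint) (use fin h in \<open>auto simp: A comp3_def\<close>)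
  moreover have "card (?B \<union> (A1 \<union> (A2 \<union> A3))) = card ?B + card (A1 \<union> (A2 \<union> A3))"
    by (rule card_Un_disjoint) (use fin in \<open>auto simp: A\<close>)
  moreover have "?B \<union> (A1 \<union> (A2 \<union> A3)) = comp3 r"
    by (auto simp: A)
  moreover have "bij_betw (\<lambda>(x, y, z). (x + h1, y, z)) (comp3 (r - h1)) A1"
    using h by (intro bij_betwI[where g = "\<lambda>(x, y, z). (x - h1, y, z)"]) (auto simp: comp3_def A)
  then have "card A1 = card (comp3 (r - h1))" by (simp add: bij_betw_same_card)
  moreover have "bij_betw (\<lambda>(x, y, z). (x, y + h2, z)) (comp3 (r - h2)) A2"
    using h by (intro bij_betwI[where g = "\<lambda>(x, y, z). (x, y - h2, z)"]) (auto simp: comp3_def A)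
  then have "card A2 = card (comp3 (r - h2))" by (simp add: bij_betw_same_card)
  moreover have "bij_betw (\<lambda>(x, y, z). (x, y, z + h3)) (comp3 (r - h3)) A3"
    using h by (intro bij_betwI[where g = "\<lambda>(x, y, z). (x, y, z - h3)"]) (auto simp: comp3_def A)
  then have "card A3 = card (comp3 (r - h3))" by (simp add: bij_betw_same_card)
  ultimately show ?thesis by (simp add: card_comp3[symmetric])
qed

text \<open>For \<open>h = r2 - m - 1\<close> this counts the pairs of rows with sums
  \<open>r\<close> and \<open>r2\<close> that together exceed \<open>m\<close> in one fixed column:
  taking \<open>m - x + 1\<close> off the offending entry of the second row leaves a composition of
  \<open>x + h\<close>.\<close>

definition ncomp3_sum :: "int \<Rightarrow> int \<Rightarrow> real" where
  "ncomp3_sum r h = (\<Sum>w\<in>comp3 r. ncomp3 (fst w + h))"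

lemma ncomp3_sum_neg: "r < 0 \<Longrightarrow> ncomp3_sum r h = 0"
  by (auto simp: ncomp3_sum_def comp3_def intro!: sum.neutral)

lemma ncomp3_sum_nat: "ncomp3_sum (int n) h = (\<Sum>k\<le>n. (real n - real k + 1) * ncomp3 (int k + h))"
  unfolding ncomp3_sum_def by (subst sum_comp3_fst) (simp add: sum_int_nat)

lemma ncomp3_sum_Suc: "ncomp3_sum (int (Suc n)) h
    = ncomp3_sum (int n) h + (\<Sum>k\<le>Suc n. ncomp3 (int k + h))"
  unfolding ncomp3_sum_nat by (simp add: algebra_simps sum.distrib sum_subtractf flip:
      sum_distrib_left)

lemma ncomp3_sum_0: "ncomp3_sum 0 h = ncomp3 h"
  using ncomp3_sum_nat[of 0 h] by simp

definition binom4 :: "real \<Rightarrow> real" where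
  "binom4 x = x * (x - 1) * (x - 2) * (x - 3) / 24"

definition binom3 :: "real \<Rightarrow> real" where
  "binom3 x = x * (x - 1) * (x - 2) / 6"

text \<open>Replacing the first part \<open>x\<close> by a composition of \<open>x + h\<close> into
  three gives all compositions of \<open>r + h\<close> into five parts, since
  \<open>h \<le> 0\<close> keeps \<open>x\<close> nonnegative. The proof is the hockey-stick
  identity applied twice.\<close>

lemma ncomp3_sum_low:
  assumes "h \<le> 0"
  shows "ncomp3_sum r h = (if r < 0 \<or> r + h < 0 then 0 else binom4 (of_int (r + h) + 4))"
proof (cases "r < 0")
  case False
  then obtain n where r: "r = int n" by (metis nonneg_int_cases not_less)
  have L: "(\<Sum>k\<le>m. ncomp3 (int k + h))
      = (if int m + h < 0 then 0 else binom3 (of_int (int m + h) + 3))" for m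
  proof (induction m)
    case 0
    then show ?case using assms by (cases "h = 0") (auto simp: ncomp3_def binom3_def)
  next
    case (Suc m)
    consider "int m + h < -1" | "int m + h = -1" | "int m + h \<ge> 0" by linarith
    then show ?case
    proof cases
      case 2
      then have "h = - int m - 1" by simp
      then show ?thesis using Suc by (simp add: ncomp3_def binom3_def)
    next
      case 3
      then show ?thesis using Suc by (simp add: ncomp3_def binom3_def field_simps)
    next
      case 1
      then have "ncomp3 (int (Suc m) + h) = 0" "int m + h < 0" "int (Suc m) + h < 0"
        by (auto simp: ncomp3_def)
      with Suc show ?thesis by simp
    qed
  qed
  have "ncomp3_sum (int m) h = (if int m + h < 0 then 0 else binom4 (of_int (int m + h) + 4))" for m
  proof (induction m)
    case 0
    then show ?case using assms by (cases "h = 0") (auto simp: ncomp3_sum_0 ncomp3_def binom4_def)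
  next
    case (Suc m)
    consider "int m + h < -1" | "int m + h = -1" | "int m + h \<ge> 0" by linarith
    then show ?case
    proof cases
      case 2
      then have "h = - int m - 1" by simp
      then show ?thesis using Suc unfolding ncomp3_sum_Suc L by (simp add: binom3_def binom4_def)
    next
      case 3
      then show ?thesis using Suc unfolding ncomp3_sum_Suc L
        by (simp add: binom3_def binom4_def field_simps)
    next
      case 1
      then have "int m + h < 0" "int (Suc m) + h < 0"
        by auto
      with Suc show ?thesis unfolding ncomp3_sum_Suc L by simp
    qed
  qed
  then show ?thesis by (simp add: r)
qed (simp add: ncomp3_sum_neg)

text \<open>For positive \<open>h\<close> both hockey-stick summations start late, and the missing
  initial segments are the two subtracted terms. These vanish for \<open>h\<close> from -2 to 0, so
  the formula agrees with \<open>ncomp3_sum_low\<close> on the overlap.\<close>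

lemma ncomp3_sum_high:
  assumes "-2 \<le> h" "0 \<le> r"
  shows "ncomp3_sum r h = binom4 (of_int (r + h) + 4) - binom4 (of_int h + 3)
    - (of_int r + 1) * binom3 (of_int h + 2)"
proof -
  obtain n where r: "r = int n" using assms by (metis nonneg_int_cases)
  have L: "(\<Sum>k\<le>m. ncomp3 (int k + h)) = binom3 (of_int (int m + h) + 3) - binom3 (of_int h + 2)"
    for m
    using assms by (induction m) (auto simp: ncomp3_poly binom3_def field_simps)
  have "ncomp3_sum (int m) h = binom4 (of_int (int m + h) + 4) - binom4 (of_int h + 3)
    - (of_int (int m) + 1) * binom3 (of_int h + 2)" for m
  proof (induction m)
    case 0
    then show ?case using assms by (simp add: ncomp3_sum_0 ncomp3_poly binom3_def binom4_def
        field_simps)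
  next
    case (Suc m)
    then show ?case unfolding ncomp3_sum_Suc L by (simp add: binom3_def binom4_def field_simps)
  qed
  then show ?thesis by (simp add: r)
qed

definition has_zero :: "int \<times> int \<times> int \<Rightarrow> bool" where
  "has_zero = (\<lambda>(x, y, z). x = 0 \<or> y = 0 \<or> z = 0)"

section \<open>Tables with equal column sums\<close>

definition tables :: "bool \<Rightarrow> bool \<Rightarrow> bool \<Rightarrow> int \<Rightarrow> int \<Rightarrow> int \<Rightarrow> int \<Rightarrow>
    ((int \<times> int \<times> int) \<times> (int \<times> int \<times> int) \<times> (int \<times> int \<times> int)) set" where
  "tables P Q R r1 r2 r3 m = {((a1, a2, a3), (b1, b2, b3), (c1, c2, c3)).
     (a1, a2, a3) \<in> comp3 r1 \<and> (b1, b2, b3) \<in> comp3 r2 \<and> (c1, c2, c3) \<in> comp3 r3 \<and>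
     a1 + b1 + c1 = m \<and> a2 + b2 + c2 = m \<and> a3 + b3 + c3 = m \<and>
     (P \<longrightarrow> has_zero (a1, a2, a3)) \<and> (Q \<longrightarrow> has_zero (b1, b2, b3)) \<and>
     (R \<longrightarrow> has_zero (c1, c2, c3))}"

definition ntab :: "bool \<Rightarrow> bool \<Rightarrow> bool \<Rightarrow> int \<Rightarrow> int \<Rightarrow> int \<Rightarrow> int \<Rightarrow> real" where
  "ntab P Q R r1 r2 r3 m = real (card (tables P Q R r1 r2 r3 m))"

lemma finite_tables: "finite (tables P Q R r1 r2 r3 m)"
  by (rule finite_subset[of _ "comp3 r1 \<times> comp3 r2 \<times> comp3 r3"])
    (auto simp: tables_def finite_comp3)

lemma ntab_swap12: "ntab P Q R r1 r2 r3 m = ntab Q P R r2 r1 r3 m"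
proof -
  have "bij_betw (\<lambda>(u, v, w). (v, u, w)) (tables P Q R r1 r2 r3 m) (tables Q P R r2 r1 r3 m)"
    by (rule bij_betwI[where g = "\<lambda>(u, v, w). (v, u, w)"]) (auto simp: tables_def)
  then show ?thesis by (simp add: ntab_def bij_betw_same_card)
qed

lemma ntab_swap23: "ntab P Q R r1 r2 r3 m = ntab P R Q r1 r3 r2 m"
proof -
  have "bij_betw (\<lambda>(u, v, w). (u, w, v)) (tables P Q R r1 r2 r3 m) (tables P R Q r1 r3 r2 m)"
    by (rule bij_betwI[where g = "\<lambda>(u, v, w). (u, w, v)"]) (auto simp: tables_def)
  then show ?thesis by (simp add: ntab_def bij_betw_same_card)
qed

text \<open>A row without zero stays nonnegative when 1 is taken off each entry; this lowers its sum
  by 3 and every column sum by 1.\<close>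

lemma ntab_zero_row1:
  "ntab True Q R r1 r2 r3 m = ntab False Q R r1 r2 r3 m - ntab False Q R (r1 - 3) r2 r3 (m - 1)"
proof -
  define S where "S = tables False Q R r1 r2 r3 m - tables True Q R r1 r2 r3 m"
  have sub: "tables True Q R r1 r2 r3 m \<subseteq> tables False Q R r1 r2 r3 m"
    by (auto simp: tables_def)
  have S: "S = {(u, v, w) \<in> tables False Q R r1 r2 r3 m. \<not> has_zero u}"
    by (auto simp: S_def tables_def)
  have "bij_betw (\<lambda>((x, y, z), v, w). ((x + 1, y + 1, z + 1), v, w))
      (tables False Q R (r1 - 3) r2 r3 (m - 1)) S"
  proof (rule bij_betwI[where g = "\<lambda>((x, y, z), v, w). ((x - 1, y - 1, z - 1), v, w)"])
    have "(x + 1, y + 1, z + 1) \<in> comp3 r1 \<and> \<not> has_zero (x + 1, y + 1, z + 1)"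
      if "(x, y, z) \<in> comp3 (r1 - 3)" for x y z
      using that by (auto simp: comp3_def has_zero_def)
    then show "(\<lambda>((x, y, z), v, w). ((x + 1, y + 1, z + 1), v, w))
        \<in> tables False Q R (r1 - 3) r2 r3 (m - 1) \<rightarrow> S"
      unfolding S by (clarsimp simp: tables_def)
    have "(x - 1, y - 1, z - 1) \<in> comp3 (r1 - 3)"
      if "(x, y, z) \<in> comp3 r1" "\<not> has_zero (x, y, z)" for x y z
      using that by (auto simp: comp3_def has_zero_def)
    then show "(\<lambda>((x, y, z), v, w). ((x - 1, y - 1, z - 1), v, w))
        \<in> S \<rightarrow> tables False Q R (r1 - 3) r2 r3 (m - 1)"
      unfolding S by (clarsimp simp: tables_def)
  qed auto
  then have "card S = card (tables False Q R (r1 - 3) r2 r3 (m - 1))"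
    by (simp add: bij_betw_same_card)
  moreover have "card S = card (tables False Q R r1 r2 r3 m) - card (tables True Q R r1 r2 r3 m)"
    unfolding S_def by (rule card_Diff_subset[OF finite_tables sub])
  moreover have "card (tables True Q R r1 r2 r3 m) \<le> card (tables False Q R r1 r2 r3 m)"
    by (rule card_mono[OF finite_tables sub])
  ultimately show ?thesis by (simp add: ntab_def)
qed

lemma ntab_zero_row2:
  "ntab P True R r1 r2 r3 m = ntab P False R r1 r2 r3 m - ntab P False R r1 (r2 - 3) r3 (m - 1)"
  using ntab_zero_row1[of P R r2 r1 r3 m] by (simp add: ntab_swap12[of P])

lemma ntab_zero_row3:
  "ntab P Q True r1 r2 r3 m = ntab P Q False r1 r2 r3 m - ntab P Q False r1 r2 (r3 - 3) (m - 1)"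
  using ntab_zero_row2[of P Q r1 r3 r2 m] by (simp add: ntab_swap23[of P Q])

section \<open>Unrestricted tables and the reduction to them\<close>

abbreviation nfree :: "int \<Rightarrow> int \<Rightarrow> int \<Rightarrow> int \<Rightarrow> real" where
  "nfree \<equiv> ntab False False False"

text \<open>Measured from the column sum, each shift moves the chosen row by -2 and the other two by
  +1. The eight terms therefore surround the original lattice point and may lie in different
  sectors.\<close>

lemma ntab_zero_rows:
  "ntab True True True r1 r2 r3 m = nfree r1 r2 r3 m
    - nfree (r1 - 3) r2 r3 (m - 1) - nfree r1 (r2 - 3) r3 (m - 1) - nfree r1 r2 (r3 - 3) (m - 1)
    + nfree (r1 - 3) (r2 - 3) r3 (m - 2) + nfree (r1 - 3) r2 (r3 - 3) (m - 2)
    + nfree r1 (r2 - 3) (r3 - 3) (m - 2) - nfree (r1 - 3) (r2 - 3) (r3 - 3) (m - 3)"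
  by (simp add: ntab_zero_row1 ntab_zero_row2 ntab_zero_row3)

text \<open>
  The third row is determined by the other two. If its sum is at least \<open>m - 1\<close>, the first two
  rows exceed \<open>m\<close> in at most one column, so inclusion-exclusion stops after one step.
\<close>
lemma nfree_eliminate:
  assumes "r1 + r2 + r3 = 3 * m" "m - 1 \<le> r3" "r1 \<le> m + 1"
  shows "nfree r1 r2 r3 m = ncomp3 r1 * ncomp3 r2 - 3 * ncomp3_sum r1 (r2 - m - 1)"
proof -
  define G where "G u = {v \<in> comp3 r2. fst v < m - fst u + 1 \<and> fst (snd v) < m - fst (snd u) + 1 \<and>
    snd (snd v) < m - snd (snd u) + 1}" for u :: "int \<times> int \<times> int"
  have "bij_betw (\<lambda>(u, v, w). (u, v)) (tables False False False r1 r2 r3 m) (Sigma (comp3 r1) G)"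
    by (rule bij_betwI[where g = "\<lambda>((a1, a2, a3), (b1, b2, b3)). ((a1, a2, a3), (b1, b2, b3),
        (m - a1 - b1, m - a2 - b2, m - a3 - b3))"])
      (use assms in \<open>auto simp: tables_def comp3_def G_def\<close>)
  then have "card (tables False False False r1 r2 r3 m) = card (Sigma (comp3 r1) G)"
    by (rule bij_betw_same_card)
  also have "\<dots> = (\<Sum>u\<in>comp3 r1. card (G u))"
    by (rule card_SigmaI) (auto simp: G_def finite_comp3 intro:
        finite_subset[OF _ finite_comp3[of r2]])
  finally have "nfree r1 r2 r3 m = (\<Sum>u\<in>comp3 r1. real (card (G u)))"
    by (simp add: ntab_def)
  also have "\<dots> = (\<Sum>u\<in>comp3 r1. ncomp3 r2 - ncomp3 (fst u + (r2 - m - 1))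
      - ncomp3 (fst (snd u) + (r2 - m - 1)) - ncomp3 (snd (snd u) + (r2 - m - 1)))"
  proof (rule sum.cong)
    \<comment> \<open>\<open>m - 1 \<le> r3\<close> gives \<open>r1 + r2 \<le> 2 * m + 1\<close>,
      less than the sum of any two bounds plus what \<open>u\<close> uses there;
      \<open>r1 \<le> m + 1\<close> keeps the bounds nonnegative.\<close>
    fix u assume u: "u \<in> comp3 r1"
    show "real (card (G u)) = ncomp3 r2 - ncomp3 (fst u + (r2 - m - 1))
      - ncomp3 (fst (snd u) + (r2 - m - 1)) - ncomp3 (snd (snd u) + (r2 - m - 1))"
      unfolding G_def
      by (subst card_box_comp3) (use u assms in \<open>auto simp: comp3_def algebra_simps\<close>)
  qed simp
  also have "\<dots> = ncomp3 r1 * ncomp3 r2 - 3 * ncomp3_sum r1 (r2 - m - 1)"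
    using sum_comp3_coord[of "\<lambda>x. ncomp3 (x + (r2 - m - 1))" r1]
    by (simp add: sum_subtractf ncomp3_sum_def card_comp3)
  finally show ?thesis .
qed

text \<open>
  With \<open>a, b \<ge> 0\<close>, a peak is a table with row sums \<open>m + a + b\<close>, \<open>m - a\<close>, \<open>m - b\<close>, and a dent one
  with row sums \<open>m + a\<close>, \<open>m + b\<close>, \<open>m - a - b\<close>. The formulas must also hold at \<open>-1\<close>, because
  the shifts in \<open>ntab_zero_rows\<close> cross the boundary between the two shapes.
\<close>
definition peak_count :: "int \<Rightarrow> int \<Rightarrow> int \<Rightarrow> real" where
  "peak_count m a b = ncomp3 (m - a) * ncomp3 (m - b)
     - (if m - a - b < 1 then 0 else 3 * binom4 (of_int (m - a - b) + 3))"

definition dent_count :: "int \<Rightarrow> int \<Rightarrow> int \<Rightarrow> real" where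
  "dent_count m a b = (if m - a - b < 0 then 0 else
     ncomp3 (m - a - b) * ncomp3 (m + a) - 3 * (binom4 (of_int (m - b) + 3) - binom4 (of_int a + 2)
       - (of_int (m - a - b) + 1) * binom3 (of_int a + 1)))"

text \<open>Eliminating the long row gives the offset \<open>h = - b - 1\<close>, which
  \<open>b \<ge> -1\<close> makes nonpositive, so \<open>ncomp3_sum_low\<close> applies on the whole
  extended range.\<close>

lemma nfree_peak:
  assumes "-1 \<le> a" "-1 \<le> b" "-1 \<le> a + b"
  shows "nfree (m + a + b) (m - a) (m - b) m = peak_count m a b"
    and "nfree (m - a) (m + a + b) (m - b) m = peak_count m a b"
    and "nfree (m - a) (m - b) (m + a + b) m = peak_count m a b"
proof -
  show *: "nfree (m - a) (m - b) (m + a + b) m = peak_count m a b"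
    using assms by (subst nfree_eliminate) (auto simp: ncomp3_sum_low peak_count_def algebra_simps)
  then show **: "nfree (m - a) (m + a + b) (m - b) m = peak_count m a b"
    by (subst ntab_swap23)
  then show "nfree (m + a + b) (m - a) (m - b) m = peak_count m a b"
    by (subst ntab_swap12)
qed

text \<open>Eliminating the row \<open>m + b\<close> gives the offset \<open>h = a - 1\<close>, and
  \<open>a \<ge> -1\<close> is exactly the bound \<open>-2 \<le> h\<close> of
  \<open>ncomp3_sum_high\<close>. The value is symmetric in \<open>a\<close> and \<open>b\<close>
  although the formula does not look so.\<close>

lemma nfree_dent:
  assumes "-1 \<le> a" "-1 \<le> b" "-1 \<le> a + b"
  shows "nfree (m - a - b) (m + a) (m + b) m = dent_count m a b"
    and "nfree (m + a) (m - a - b) (m + b) m = dent_count m a b"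
    and "nfree (m + a) (m + b) (m - a - b) m = dent_count m a b"
proof -
  show *: "nfree (m - a - b) (m + a) (m + b) m = dent_count m a b"
    using assms by (subst nfree_eliminate)
        (auto simp: ncomp3_sum_high ncomp3_sum_neg dent_count_def algebra_simps ncomp3_neg)
  then show **: "nfree (m + a) (m - a - b) (m + b) m = dent_count m a b"
    by (subst ntab_swap12)
  then show "nfree (m + a) (m + b) (m - a - b) m = dent_count m a b"
    by (subst ntab_swap23)
qed

lemma peak_count_poly:
  assumes "-3 \<le> m - a - b" "-2 \<le> m - a" "-2 \<le> m - b"
  shows "peak_count m a b = (of_int m - of_int a + 1) * (of_int m - of_int a + 2) / 2
      * ((of_int m - of_int b + 1) * (of_int m - of_int b + 2) / 2)
      - 3 * binom4 (of_int m - of_int a - of_int b + 3)"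
proof -
  have "binom4 (of_int m - of_int a - of_int b + 3) = 0" if "m - a - b < 1"
  proof -
    from that assms consider "m = a + b - 3" | "m = a + b - 2" | "m = a + b - 1" | "m = a + b"
      by linarith
    then show ?thesis by cases (auto simp: binom4_def)
  qed
  then show ?thesis using assms by (auto simp: peak_count_def ncomp3_poly)
qed

text \<open>At \<open>m - a - b = -1\<close> the \<open>binom4\<close> terms cancel; at -2 the
  remaining terms cancel by Pascal's rule.\<close>

lemma dent_count_poly:
  assumes "-2 \<le> m - a - b" "-2 \<le> m + a"
  shows "dent_count m a b = (of_int m - of_int a - of_int b + 1)
      * (of_int m - of_int a - of_int b + 2) / 2
      * ((of_int m + of_int a + 1) * (of_int m + of_int a + 2) / 2)
      - 3 * (binom4 (of_int m - of_int b + 3) - binom4 (of_int a + 2)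
       - (of_int m - of_int a - of_int b + 1) * binom3 (of_int a + 1))"
proof (cases "m - a - b < 0")
  case True
  with assms consider "m = a + b - 2" | "m = a + b - 1" by linarith
  then show ?thesis
    by cases (hypsubst, simp add: dent_count_def binom3_def binom4_def field_simps)+
qed (use assms in \<open>auto simp: dent_count_def ncomp3_poly\<close>)

lemma dent_count_neg: "m - a - b < 0 \<Longrightarrow> dent_count m a b = 0"
  by (simp add: dent_count_def)

section \<open>Tables with a zero in every row, by position in the hexagonal lattice\<close>

text \<open>The value can be seen directly. The long row has one zero and entries
  \<open>m - t\<close> and \<open>a + b + t\<close> with \<open>0 \<le> t \<le> n\<close>, leaving
  column capacities \<open>m\<close>, \<open>t\<close>, \<open>n - t\<close>. The other rows have no
  zero in the first of these columns, so they can be chosen in 2 ways for \<open>0 < t < n\<close>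
  and in \<open>n + 1\<close> ways for \<open>t = 0\<close> or \<open>t = n\<close>; the position of
  the zero gives a factor 3. For \<open>n = 0\<close> the two extreme cases coincide.\<close>

lemma ntab_zero_rows_peak:
  fixes n :: int
  assumes "0 \<le> n" "1 \<le> a" "1 \<le> b" and m: "m = n + a + b"
  shows "ntab True True True (m + a + b) (m - a) (m - b) m
    = 12 * of_int n + (if n = 0 then 3 else 0)"
proof -
  have term0: "nfree (m + a + b) (m - a) (m - b) m = peak_count m a b"
    using nfree_peak(1)[of "a" "b" "m"] assms(1-3) by (simp add: algebra_simps)
  have term1: "nfree (m + a + b - 3) (m - a) (m - b) (m - 1) = peak_count (m - 1) (a - 1) (b - 1)"
    using nfree_peak(1)[of "a - 1" "b - 1" "m - 1"] assms(1-3) by (simp add: algebra_simps)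
  have term2: "nfree (m + a + b) (m - a - 3) (m - b) (m - 1) = peak_count (m - 1) (a + 2) (b - 1)"
    using nfree_peak(1)[of "a + 2" "b - 1" "m - 1"] assms(1-3) by (simp add: algebra_simps)
  have term3: "nfree (m + a + b) (m - a) (m - b - 3) (m - 1) = peak_count (m - 1) (a - 1) (b + 2)"
    using nfree_peak(1)[of "a - 1" "b + 2" "m - 1"] assms(1-3) by (simp add: algebra_simps)
  have term4: "nfree (m + a + b - 3) (m - a - 3) (m - b) (m - 2)
      = peak_count (m - 2) (a + 1) (b - 2)"
    using nfree_peak(1)[of "a + 1" "b - 2" "m - 2"] assms(1-3) by (simp add: algebra_simps)
  have term5: "nfree (m + a + b - 3) (m - a) (m - b - 3) (m - 2)
      = peak_count (m - 2) (a - 2) (b + 1)"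
    using nfree_peak(1)[of "a - 2" "b + 1" "m - 2"] assms(1-3) by (simp add: algebra_simps)
  have term6: "nfree (m + a + b) (m - a - 3) (m - b - 3) (m - 2)
      = peak_count (m - 2) (a + 1) (b + 1)"
    using nfree_peak(1)[of "a + 1" "b + 1" "m - 2"] assms(1-3) by (simp add: algebra_simps)
  have term7: "nfree (m + a + b - 3) (m - a - 3) (m - b - 3) (m - 3) = peak_count (m - 3) a b"
    using nfree_peak(1)[of "a" "b" "m - 3"] assms(1-3) by (simp add: algebra_simps)
  show ?thesis
  \<comment> \<open>For \<open>n \<ge> 1\<close> all eight terms stay within
    \<open>peak_count_poly\<close>, the lowest having \<open>m - a - b\<close> replaced by
    \<open>n - 4\<close>. For \<open>n = 0\<close> that term falls just outside, which produces the
    extra constant.\<close>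
  proof (cases "n = 0")
    case True
    then show ?thesis unfolding ntab_zero_rows term0 term1 term2 term3 term4 term5 term6 term7
        using assms
      by (simp add: peak_count_def dent_count_neg dent_count_poly ncomp3_poly ncomp3_neg
          binom3_def binom4_def)
        (simp add: field_simps)?
  next
    case False
    then have "1 \<le> n" using assms by simp
    with False show ?thesis unfolding ntab_zero_rows term0 term1 term2 term3 term4 term5 term6
        term7 using assms
      by (simp add: peak_count_poly dent_count_poly dent_count_neg binom3_def binom4_def)
        (simp add: field_simps)?
  qed
qed

text \<open>The short row has sum \<open>n\<close>, hence \<open>3 * n\<close> choices with a zero
  (one if \<open>n = 0\<close>). The other two rows must have their zeros in different columns, and
  the 6 ways to place these determine both rows.\<close>

lemma ntab_zero_rows_dent:
  fixes n :: int
  assumes "0 \<le> n" "1 \<le> a" "1 \<le> b" and m: "m = n + a + b"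
  shows "ntab True True True (m + a) (m + b) (m - a - b) m
    = 18 * of_int n + (if n = 0 then 6 else 0)"
proof -
  have term0: "nfree (m + a) (m + b) (m - a - b) m = dent_count m a b"
    using nfree_dent(3)[of "a" "b" "m"] assms(1-3) by (simp add: algebra_simps)
  have term1: "nfree (m + a - 3) (m + b) (m - a - b) (m - 1) = dent_count (m - 1) (a - 2) (b + 1)"
    using nfree_dent(3)[of "a - 2" "b + 1" "m - 1"] assms(1-3) by (simp add: algebra_simps)
  have term2: "nfree (m + a) (m + b - 3) (m - a - b) (m - 1) = dent_count (m - 1) (a + 1) (b - 2)"
    using nfree_dent(3)[of "a + 1" "b - 2" "m - 1"] assms(1-3) by (simp add: algebra_simps)
  have term3: "nfree (m + a) (m + b) (m - a - b - 3) (m - 1) = dent_count (m - 1) (a + 1) (b + 1)"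
    using nfree_dent(3)[of "a + 1" "b + 1" "m - 1"] assms(1-3) by (simp add: algebra_simps)
  have term4: "nfree (m + a - 3) (m + b - 3) (m - a - b) (m - 2)
      = dent_count (m - 2) (a - 1) (b - 1)"
    using nfree_dent(3)[of "a - 1" "b - 1" "m - 2"] assms(1-3) by (simp add: algebra_simps)
  have term5: "nfree (m + a - 3) (m + b) (m - a - b - 3) (m - 2)
      = dent_count (m - 2) (a - 1) (b + 2)"
    using nfree_dent(3)[of "a - 1" "b + 2" "m - 2"] assms(1-3) by (simp add: algebra_simps)
  have term6: "nfree (m + a) (m + b - 3) (m - a - b - 3) (m - 2)
      = dent_count (m - 2) (a + 2) (b - 1)"
    using nfree_dent(3)[of "a + 2" "b - 1" "m - 2"] assms(1-3) by (simp add: algebra_simps)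
  have term7: "nfree (m + a - 3) (m + b - 3) (m - a - b - 3) (m - 3) = dent_count (m - 3) a b"
    using nfree_dent(3)[of "a" "b" "m - 3"] assms(1-3) by (simp add: algebra_simps)
  show ?thesis
  proof (cases "n = 0")
    case True
    then show ?thesis unfolding ntab_zero_rows term0 term1 term2 term3 term4 term5 term6 term7
        using assms
      by (simp add: peak_count_def dent_count_neg dent_count_poly ncomp3_poly ncomp3_neg
          binom3_def binom4_def)
        (simp add: field_simps)?
  next
    case False
    then have "1 \<le> n" using assms by simp
    with False show ?thesis unfolding ntab_zero_rows term0 term1 term2 term3 term4 term5 term6
        term7 using assms
      by (simp add: peak_count_poly dent_count_poly dent_count_neg binom3_def binom4_def)
        (simp add: field_simps)?
  qed
qed

text \<open>On a ray between two sectors the shifts reach both sides, so peaks and dents mix and the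
  index -1 occurs.\<close>

lemma ntab_zero_rows_axis:
  fixes n :: int
  assumes "0 \<le> n" "1 \<le> a" and m: "m = n + a"
  shows "ntab True True True (m + a) (m - a) (m) m
    = 15 * of_int n - 3 + (if n = 0 then 6 else 0)"
proof -
  have term0: "nfree (m + a) (m - a) (m) m = peak_count m a 0"
    using nfree_peak(1)[of "a" "0" "m"] assms(1-2) by (simp add: algebra_simps)
  have term1: "nfree (m + a - 3) (m - a) (m) (m - 1) = peak_count (m - 1) (a - 1) (-1)"
    using nfree_peak(1)[of "a - 1" "-1" "m - 1"] assms(1-2) by (simp add: algebra_simps)
  have term2: "nfree (m + a) (m - a - 3) (m) (m - 1) = peak_count (m - 1) (a + 2) (-1)"
    using nfree_peak(1)[of "a + 2" "-1" "m - 1"] assms(1-2) by (simp add: algebra_simps)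
  have term3: "nfree (m + a) (m - a) (m - 3) (m - 1) = peak_count (m - 1) (a - 1) (2)"
    using nfree_peak(1)[of "a - 1" "2" "m - 1"] assms(1-2) by (simp add: algebra_simps)
  have term4: "nfree (m + a - 3) (m - a - 3) (m) (m - 2) = dent_count (m - 2) (a - 1) (2)"
    using nfree_dent(2)[of "a - 1" "2" "m - 2"] assms(1-2) by (simp add: algebra_simps)
  have term5: "nfree (m + a - 3) (m - a) (m - 3) (m - 2) = peak_count (m - 2) (a - 2) (1)"
    using nfree_peak(1)[of "a - 2" "1" "m - 2"] assms(1-2) by (simp add: algebra_simps)
  have term6: "nfree (m + a) (m - a - 3) (m - 3) (m - 2) = peak_count (m - 2) (a + 1) (1)"
    using nfree_peak(1)[of "a + 1" "1" "m - 2"] assms(1-2) by (simp add: algebra_simps)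
  have term7: "nfree (m + a - 3) (m - a - 3) (m - 3) (m - 3) = peak_count (m - 3) a 0"
    using nfree_peak(1)[of "a" "0" "m - 3"] assms(1-2) by (simp add: algebra_simps)
  show ?thesis
  proof (cases "n = 0")
    case True
    then show ?thesis unfolding ntab_zero_rows term0 term1 term2 term3 term4 term5 term6 term7
        using assms
      by (simp add: peak_count_def dent_count_neg dent_count_poly ncomp3_poly ncomp3_neg
          binom3_def binom4_def)
        (simp add: field_simps)?
  next
    case False
    then have "1 \<le> n" using assms by simp
    with False show ?thesis unfolding ntab_zero_rows term0 term1 term2 term3 term4 term5 term6
        term7 using assms
      by (simp add: peak_count_poly dent_count_poly dent_count_neg binom3_def binom4_def)
        (simp add: field_simps)?
  qed
qed

text \<open>Here the deviations 1, 1, -2 can be read as \<open>dent_count _ 1 1\<close> or as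
  \<open>peak_count _ 2 (-1)\<close>; both readings are used, according to which row is
  shifted.\<close>

lemma ntab_zero_rows_center:
  fixes n :: int
  assumes "0 \<le> n" and m: "m = n"
  shows "ntab True True True (m) (m) (m) m
    = 15 * of_int n - 9 + (if n = 0 then 10 else 0)"
proof -
  have term0: "nfree (m) (m) (m) m = peak_count m 0 0"
    using nfree_peak(1)[of "0" "0" "m"] assms(1-1) by (simp add: algebra_simps)
  have term1: "nfree (m - 3) (m) (m) (m - 1) = dent_count (m - 1) (1) (1)"
    using nfree_dent(1)[of "1" "1" "m - 1"] assms(1-1) by (simp add: algebra_simps)
  have term2: "nfree (m) (m - 3) (m) (m - 1) = peak_count (m - 1) (2) (-1)"
    using nfree_peak(1)[of "2" "-1" "m - 1"] assms(1-1) by (simp add: algebra_simps)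
  have term3: "nfree (m) (m) (m - 3) (m - 1) = peak_count (m - 1) (-1) (2)"
    using nfree_peak(1)[of "-1" "2" "m - 1"] assms(1-1) by (simp add: algebra_simps)
  have term4: "nfree (m - 3) (m - 3) (m) (m - 2) = dent_count (m - 2) (-1) (2)"
    using nfree_dent(1)[of "-1" "2" "m - 2"] assms(1-1) by (simp add: algebra_simps)
  have term5: "nfree (m - 3) (m) (m - 3) (m - 2) = dent_count (m - 2) (2) (-1)"
    using nfree_dent(1)[of "2" "-1" "m - 2"] assms(1-1) by (simp add: algebra_simps)
  have term6: "nfree (m) (m - 3) (m - 3) (m - 2) = peak_count (m - 2) (1) (1)"
    using nfree_peak(1)[of "1" "1" "m - 2"] assms(1-1) by (simp add: algebra_simps)
  have term7: "nfree (m - 3) (m - 3) (m - 3) (m - 3) = peak_count (m - 3) 0 0"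
    using nfree_peak(1)[of "0" "0" "m - 3"] assms(1-1) by (simp add: algebra_simps)
  show ?thesis
  proof (cases "n = 0")
    case True
    then show ?thesis unfolding ntab_zero_rows term0 term1 term2 term3 term4 term5 term6 term7
        using assms
      by (simp add: peak_count_def dent_count_neg dent_count_poly ncomp3_poly ncomp3_neg
          binom3_def binom4_def)
        (simp add: field_simps)?
  next
    case False
    then have "1 \<le> n" using assms by simp
    with False show ?thesis unfolding ntab_zero_rows term0 term1 term2 term3 term4 term5 term6
        term7 using assms
      by (simp add: peak_count_poly dent_count_poly dent_count_neg binom3_def binom4_def)
        (simp add: field_simps)?
  qed
qed

section \<open>Cubes as pairs of tables\<close>

text \<open>
  The entry of a layer at \<open>(j, k)\<close> is written as \<open>a (k - j) + b (k + j)\<close> with indices modulo 3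
  (the index 0 is written as 1, and so on). Only a constant can be moved between \<open>a\<close> and \<open>b\<close>;
  requiring a zero in \<open>a\<close> makes the decomposition unique.
\<close>
lemma layer_decompose:
  fixes x11 x12 x13 x21 x22 x23 x31 x32 x33 s :: int
  assumes "0 \<le> x11" "0 \<le> x12" "0 \<le> x13" "0 \<le> x21" "0 \<le> x22" "0 \<le> x23" "0 \<le> x31" "0 \<le> x32" "0 \<le> x33"
    and "x11 + x12 + x13 = s" "x21 + x22 + x23 = s" "x31 + x32 + x33 = s"
    and "x11 + x21 + x31 = s" "x12 + x22 + x32 = s" "x13 + x23 + x33 = s"
  obtains a1 a2 a3 b1 b2 b3 where
    "0 \<le> a1" "0 \<le> a2" "0 \<le> a3" "0 \<le> b1" "0 \<le> b2" "0 \<le> b3" "has_zero (a1, a2, a3)"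
    "x11 = a1 + b1" "x12 = a2 + b2" "x13 = a3 + b3"
    "x21 = a3 + b2" "x22 = a1 + b3" "x23 = a2 + b1"
    "x31 = a2 + b3" "x32 = a3 + b1" "x33 = a1 + b2"
proof -
  \<comment> \<open>These three entries are \<open>a1 + b1\<close>, \<open>a2 + b1\<close>,
    \<open>a3 + b1\<close>. Their minimum must be \<open>b1\<close>, the differences are
    \<open>a\<close>, and \<open>b2\<close>, \<open>b3\<close> are the entries where the vanishing
    \<open>a\<close> meets them.\<close>
  consider "x11 \<le> x23" "x11 \<le> x32" | "x23 \<le> x11" "x23 \<le> x32" | "x32 \<le> x11" "x32 \<le> x23"
    by linarith
  then show thesis
  proof cases
    case 1
    show thesis
      by (rule that[of 0 "x23 - x11" "x32 - x11" x11 x33 x22])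
          (use assms 1 in \<open>auto simp: has_zero_def\<close>)
  next
    case 2
    show thesis
      by (rule that[of "x11 - x23" 0 "x32 - x23" x23 x12 x31])
          (use assms 2 in \<open>auto simp: has_zero_def\<close>)
  next
    case 3
    show thesis
      by (rule that[of "x11 - x32" "x23 - x32" 0 x32 x21 x13])
          (use assms 3 in \<open>auto simp: has_zero_def\<close>)
  qed
qed

text \<open>The equations make the two \<open>a\<close>-triples differ by a constant; since both are
  nonnegative with a zero, their minima are 0 and the constant is 0.\<close>

lemma layer_unique:
  fixes a1 a2 a3 b1 b2 b3 :: int
  assumes "has_zero (a1, a2, a3)" "has_zero (a1', a2', a3')"
    "0 \<le> a1" "0 \<le> a2" "0 \<le> a3" "0 \<le> a1'" "0 \<le> a2'" "0 \<le> a3'"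
    "a1 + b1 = a1' + b1'" "a2 + b1 = a2' + b1'" "a3 + b1 = a3' + b1'"
    "a1 + b2 = a1' + b2'" "a1 + b3 = a1' + b3'"
  shows "(a1, a2, a3) = (a1', a2', a3') \<and> (b1, b2, b3) = (b1', b2', b3')"
  using assms unfolding has_zero_def by (auto; linarith)

section \<open>The bijection between cubes and pairs of tables\<close>

type_synonym triple = "int \<times> int \<times> int"

fun layer :: "triple \<Rightarrow> triple \<Rightarrow> nat ^ 3 ^ 3" where
  "layer (a1, a2, a3) (b1, b2, b3) = vector [
     vector [nat (a1 + b1), nat (a2 + b2), nat (a3 + b3)],
     vector [nat (a3 + b2), nat (a1 + b3), nat (a2 + b1)],
     vector [nat (a2 + b3), nat (a3 + b1), nat (a1 + b2)]]"

lemma vector3_eq: "(vector [x, y, z] :: 'a::zero ^ 3) = vector [x', y', z'] \<longleftrightarrow> x = x' \<and> y = y' \<and> z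
    = z'"
  by (metis vector_3)

definition nonneg3 :: "triple \<Rightarrow> bool" where
  "nonneg3 = (\<lambda>(x, y, z). 0 \<le> x \<and> 0 \<le> y \<and> 0 \<le> z)"

lemma layer_inj:
  assumes "layer a b = layer a' b'" "has_zero a" "has_zero a'"
    "nonneg3 a" "nonneg3 a'" "nonneg3 b" "nonneg3 b'"
  shows "a = a' \<and> b = b'"
proof -
  obtain a1 a2 a3 where ta: "a = (a1, a2, a3)" by (rule prod_cases3)
  obtain b1 b2 b3 where tb: "b = (b1, b2, b3)" by (rule prod_cases3)
  obtain c1 c2 c3 where tc: "a' = (c1, c2, c3)" by (rule prod_cases3)
  obtain d1 d2 d3 where td: "b' = (d1, d2, d3)" by (rule prod_cases3)
  note ab = ta tb and cd = tc td
  have "nat (a1 + b1) = nat (c1 + d1)" "nat (a2 + b1) = nat (c2 + d1)" "nat (a3 + b1)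
      = nat (c3 + d1)"
    "nat (a1 + b2) = nat (c1 + d2)" "nat (a1 + b3) = nat (c1 + d3)"
    using assms(1) by (simp_all add: ab cd vector3_eq)
  then have "a1 + b1 = c1 + d1" "a2 + b1 = c2 + d1" "a3 + b1 = c3 + d1"
    "a1 + b2 = c1 + d2" "a1 + b3 = c1 + d3"
    using assms(4-7) by (simp_all add: ab cd nonneg3_def eq_nat_nat_iff add_nonneg_nonneg)
  then show ?thesis
    using layer_unique[of a1 a2 a3 c1 c2 c3 b1 d1 b2 d2 b3 d3] assms(2-7)
    by (simp add: ab cd nonneg3_def)
qed

lemma layer_surj:
  fixes X :: "nat ^ 3 ^ 3"
  assumes "\<And>j. (\<Sum>k\<in>UNIV. X $ j $ k) = s" "\<And>k. (\<Sum>j\<in>UNIV. X $ j $ k) = s"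
  obtains a b where "nonneg3 a" "nonneg3 b" "has_zero a" "X = layer a b"
proof -
  have r: "int (X $ j $ 1) + int (X $ j $ 2) + int (X $ j $ 3) = int s" for j
    using assms(1)[of j] by (simp add: sum_3 flip: of_nat_add)
  have c: "int (X $ 1 $ k) + int (X $ 2 $ k) + int (X $ 3 $ k) = int s" for k
    using assms(2)[of k] by (simp add: sum_3 flip: of_nat_add)
  have v: "Y = vector [Y $ 1, Y $ 2, Y $ 3]" for Y :: "'z::zero ^ 3"
    by (simp add: vec_eq_iff forall_3)
  obtain a1 a2 a3 b1 b2 b3 where
    nn: "0 \<le> a1" "0 \<le> a2" "0 \<le> a3" "0 \<le> b1" "0 \<le> b2" "0 \<le> b3" "has_zero (a1, a2, a3)" and e:
    "int (X $ 1 $ 1) = a1 + b1" "int (X $ 1 $ 2) = a2 + b2" "int (X $ 1 $ 3) = a3 + b3"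
    "int (X $ 2 $ 1) = a3 + b2" "int (X $ 2 $ 2) = a1 + b3" "int (X $ 2 $ 3) = a2 + b1"
    "int (X $ 3 $ 1) = a2 + b3" "int (X $ 3 $ 2) = a3 + b1" "int (X $ 3 $ 3) = a1 + b2"
    by (rule layer_decompose[OF _ _ _ _ _ _ _ _ _ r[of 1] r[of 2] r[of 3] c[of 1] c[of 2]
        c[of 3]]) auto
  have "X = layer (a1, a2, a3) (b1, b2, b3)"
    by (simp add: vec_eq_iff forall_3 flip: e)
  then show thesis using nn by (intro that[of "(a1, a2, a3)" "(b1, b2, b3)"])
      (auto simp: nonneg3_def)
qed

text \<open>
  \<open>(m, x, y)\<close> encodes tables with column sums \<open>m\<close> and row sums \<open>m + x\<close>, \<open>m + y\<close>,
  \<open>m - x - y\<close>. A row with a zero has sum at most \<open>2 * m\<close>, so \<open>(x, y)\<close> lies in a hexagon.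
\<close>
definition index_set :: "nat \<Rightarrow> (int \<times> int \<times> int) set" where
  "index_set s = {(m, x, y). 0 \<le> m \<and> m \<le> int s \<and> \<bar>x\<bar> \<le> m \<and> \<bar>y\<bar> \<le> m \<and> \<bar>x + y\<bar> \<le> m}"

definition pieces :: "nat \<Rightarrow> triple \<Rightarrow>
    ((triple \<times> triple \<times> triple) \<times> (triple \<times> triple \<times> triple)) set" where
  "pieces s = (\<lambda>(m, x, y). tables True True True (m + x) (m + y) (m - x - y) m \<times>
     tables False False False (int s - m - x) (int s - m - y) (int s - m + x + y) (int s - m))"

fun cube_of :: "(triple \<times> triple \<times> triple) \<times> (triple \<times> triple \<times> triple) \<Rightarrow> nat ^ 3 ^ 3 ^ 3" where
  "cube_of ((a, b, c), (a', b', c')) = vector [layer a a', layer b b', layer c c']"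

lemma pieces_nonneg:
  assumes "((a, b, c), (a', b', c')) \<in> pieces s i"
  shows "nonneg3 a \<and> nonneg3 b \<and> nonneg3 c \<and> nonneg3 a' \<and> nonneg3 b' \<and> nonneg3 c' \<and>
    has_zero a \<and> has_zero b \<and> has_zero c"
  using assms by (auto simp: pieces_def tables_def comp3_def nonneg3_def)

lemma inj_cube_of: "inj_on (\<lambda>(i, p). cube_of p) (Sigma (index_set s) (pieces s))"
proof (rule inj_onI)
  fix P P' assume P: "P \<in> Sigma (index_set s) (pieces s)" "P' \<in> Sigma (index_set s) (pieces s)"
    and eq: "(\<lambda>(i, p). cube_of p) P = (\<lambda>(i, p). cube_of p) P'"
  obtain i u v where P0: "P = (i, u, v)" by (rule prod_cases3)
  obtain a b c where u: "u = (a, b, c)" by (rule prod_cases3)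
  obtain d e f where v: "v = (d, e, f)" by (rule prod_cases3)
  note p = P0[unfolded u v]
  obtain i' u v where P0: "P' = (i', u, v)" by (rule prod_cases3)
  obtain a' b' c' where u: "u = (a', b', c')" by (rule prod_cases3)
  obtain d' e' f' where v: "v = (d', e', f')" by (rule prod_cases3)
  note p' = P0[unfolded u v]
  have mem: "((a, b, c), (d, e, f)) \<in> pieces s i" "((a', b', c'), (d', e', f')) \<in> pieces s i'"
    using P by (auto simp: p p')
  have "layer a d = layer a' d'" "layer b e = layer b' e'" "layer c f = layer c' f'"
    using eq by (simp_all add: p p' vector3_eq)
  then have same: "a = a' \<and> d = d'" "b = b' \<and> e = e'" "c = c' \<and> f = f'"
    using pieces_nonneg[OF mem(1)] pieces_nonneg[OF mem(2)] by (metis layer_inj)+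
  moreover have "i = i'"
  proof -
    obtain m x y where i: "i = (m, x, y)" by (rule prod_cases3)
    obtain m' x' y' where i': "i' = (m', x', y')" by (rule prod_cases3)
  obtain a1 a2 a3 where ta: "a = (a1, a2, a3)" by (rule prod_cases3)
  obtain b1 b2 b3 where tb: "b = (b1, b2, b3)" by (rule prod_cases3)
  obtain c1 c2 c3 where tc: "c = (c1, c2, c3)" by (rule prod_cases3)
    have "a1 + b1 + c1 = m" "a1 + b1 + c1 = m'" "a1 + a2 + a3 = m + x" "a1 + a2 + a3 = m' + x'"
      "b1 + b2 + b3 = m + y" "b1 + b2 + b3 = m' + y'"
      using mem same by (auto simp: i i' ta tb tc pieces_def tables_def comp3_def)
    then show ?thesis by (simp add: i i')
  qed
  ultimately show "P = P'" by (simp add: p p')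
qed

lemma cube_of_semi_magic:
  assumes "i \<in> index_set s" "p \<in> pieces s i"
  shows "semi_magic_cube s (cube_of p)"
proof -
  obtain m x y where i: "i = (m, x, y)" by (metis prod_cases3)
  obtain u v where p: "p = (u, v)" by (cases p)
  obtain a b c where u: "u = (a, b, c)" by (rule prod_cases3)
  obtain d e f where v: "v = (d, e, f)" by (rule prod_cases3)
  obtain a1 a2 a3 where ta: "a = (a1, a2, a3)" by (rule prod_cases3)
  obtain b1 b2 b3 where tb: "b = (b1, b2, b3)" by (rule prod_cases3)
  obtain c1 c2 c3 where tc: "c = (c1, c2, c3)" by (rule prod_cases3)
  obtain d1 d2 d3 where td: "d = (d1, d2, d3)" by (rule prod_cases3)
  obtain e1 e2 e3 where te: "e = (e1, e2, e3)" by (rule prod_cases3)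
  obtain f1 f2 f3 where tf: "f = (f1, f2, f3)" by (rule prod_cases3)
  note t = p u v ta tb tc td te tf
  have "((a1, a2, a3), (b1, b2, b3), (c1, c2, c3)) \<in> tables True True True (m + x) (m + y)
      (m - x - y) m"
    "((d1, d2, d3), (e1, e2, e3), (f1, f2, f3))
      \<in> tables False False False (int s - m - x) (int s - m - y) (int s - m + x + y) (int s - m)"
    using assms(2) by (simp_all add: i t pieces_def)
  then have *: "0 \<le> a1 \<and> 0 \<le> a2 \<and> 0 \<le> a3 \<and> a1 + a2 + a3 = m + x"
    "0 \<le> b1 \<and> 0 \<le> b2 \<and> 0 \<le> b3 \<and> b1 + b2 + b3 = m + y"
    "0 \<le> c1 \<and> 0 \<le> c2 \<and> 0 \<le> c3 \<and> c1 + c2 + c3 = m - x - y"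
    "0 \<le> d1 \<and> 0 \<le> d2 \<and> 0 \<le> d3 \<and> d1 + d2 + d3 = int s - m - x"
    "0 \<le> e1 \<and> 0 \<le> e2 \<and> 0 \<le> e3 \<and> e1 + e2 + e3 = int s - m - y"
    "0 \<le> f1 \<and> 0 \<le> f2 \<and> 0 \<le> f3 \<and> f1 + f2 + f3 = int s - m + x + y"
    "a1 + b1 + c1 = m" "a2 + b2 + c2 = m" "a3 + b3 + c3 = m"
    "d1 + e1 + f1 = int s - m" "d2 + e2 + f2 = int s - m" "d3 + e3 + f3 = int s - m"
    unfolding tables_def comp3_def by (simp_all only: mem_Collect_eq prod.case)
  then have nn: "0 \<le> a1" "0 \<le> a2" "0 \<le> a3" "0 \<le> b1" "0 \<le> b2" "0 \<le> b3" "0 \<le> c1" "0 \<le> c2" "0 \<le> c3"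
    "0 \<le> d1" "0 \<le> d2" "0 \<le> d3" "0 \<le> e1" "0 \<le> e2" "0 \<le> e3" "0 \<le> f1" "0 \<le> f2" "0 \<le> f3"
    by blast+
  from * have sums: "a1 + a2 + a3 = m + x" "b1 + b2 + b3 = m + y" "c1 + c2 + c3 = m - x - y"
    "d1 + d2 + d3 = int s - m - x" "e1 + e2 + e3 = int s - m - y" "f1 + f2 + f3 = int s - m + x + y"
    "a1 + b1 + c1 = m" "a2 + b2 + c2 = m" "a3 + b3 + c3 = m"
    "d1 + e1 + f1 = int s - m" "d2 + e2 + f2 = int s - m" "d3 + e3 + f3 = int s - m"
    by blast+
  have nat_sum: "nat u + nat v + nat w = s" if "0 \<le> u" "0 \<le> v" "0 \<le> w" "u + v + w = int s" for u v w
    using that by linarith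
  show ?thesis
    unfolding semi_magic_cube_def t
    by (simp only: forall_3 sum_3 cube_of.simps layer.simps vector_3)
      (intro conjI; rule nat_sum; (intro add_nonneg_nonneg nn)?; use sums in linarith)
qed

lemma cube_of_surj:
  assumes A: "semi_magic_cube s A"
  shows "A \<in> (\<lambda>(i, p). cube_of p) ` Sigma (index_set s) (pieces s)"
proof -
  have lay: "\<exists>a b. nonneg3 a \<and> nonneg3 b \<and> has_zero a \<and> A $ i = layer a b" for i
  proof -
    have "(\<Sum>k\<in>UNIV. A $ i $ j $ k) = s" "(\<Sum>j\<in>UNIV. A $ i $ j $ k) = s" for j k
      using A by (simp_all add: semi_magic_cube_def)
    then show ?thesis by (rule layer_surj) blast
  qed
  obtain a d where ad: "nonneg3 a" "nonneg3 d" "has_zero a" "A $ 1 = layer a d" using lay by blast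
  obtain b e where be: "nonneg3 b" "nonneg3 e" "has_zero b" "A $ 2 = layer b e" using lay by blast
  obtain c f where cf: "nonneg3 c" "nonneg3 f" "has_zero c" "A $ 3 = layer c f" using lay by blast
  have Aeq: "A = cube_of ((a, b, c), (d, e, f))"
    by (simp add: vec_eq_iff[of A] forall_3 ad be cf)
  obtain a1 a2 a3 where ta: "a = (a1, a2, a3)" by (rule prod_cases3)
  obtain b1 b2 b3 where tb: "b = (b1, b2, b3)" by (rule prod_cases3)
  obtain c1 c2 c3 where tc: "c = (c1, c2, c3)" by (rule prod_cases3)
  obtain d1 d2 d3 where td: "d = (d1, d2, d3)" by (rule prod_cases3)
  obtain e1 e2 e3 where te: "e = (e1, e2, e3)" by (rule prod_cases3)
  obtain f1 f2 f3 where tf: "f = (f1, f2, f3)" by (rule prod_cases3)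
  note t = ta tb tc and t' = td te tf
  have nn: "0 \<le> a1" "0 \<le> a2" "0 \<le> a3" "0 \<le> b1" "0 \<le> b2" "0 \<le> b3" "0 \<le> c1" "0 \<le> c2" "0 \<le> c3"
    "0 \<le> d1" "0 \<le> d2" "0 \<le> d3" "0 \<le> e1" "0 \<le> e2" "0 \<le> e3" "0 \<le> f1" "0 \<le> f2" "0 \<le> f3"
    using ad be cf by (simp_all add: t t' nonneg3_def)
  have lines: "(\<Sum>k\<in>UNIV. A $ i $ j $ k) = s" "(\<Sum>i\<in>UNIV. A $ i $ j $ k) = s" for i j k
    using A by (simp_all add: semi_magic_cube_def)
  have int_sum: "u + v + w = int s" if "nat u + nat v + nat w = s" "0 \<le> u" "0 \<le> v" "0 \<le> w" for u v w
    using that by linarith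
  note expand = Aeq t t' cube_of.simps layer.simps vector_3 sum_3
  \<comment> \<open>Eight lines suffice. The first row of each layer makes the row sums
    complementary. Of the lines across layers, three combine \<open>d1\<close>, \<open>e1\<close>,
    \<open>f1\<close> with each column of the first table and two combine \<open>a1\<close>,
    \<open>b1\<close>, \<open>c1\<close> with the remaining columns of the second; comparing them
    gives equal column sums.\<close>
  have l0: "(a1 + d1) + (a2 + d2) + (a3 + d3) = int s"
    by (rule int_sum[OF lines(1)[of 1 1, unfolded expand]]; use nn in linarith)
  have l1: "(b1 + e1) + (b2 + e2) + (b3 + e3) = int s"
    by (rule int_sum[OF lines(1)[of 2 1, unfolded expand]]; use nn in linarith)
  have l2: "(c1 + f1) + (c2 + f2) + (c3 + f3) = int s"
    by (rule int_sum[OF lines(1)[of 3 1, unfolded expand]]; use nn in linarith)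
  have l3: "(a1 + d1) + (b1 + e1) + (c1 + f1) = int s"
    by (rule int_sum[OF lines(2)[of 1 1, unfolded expand]]; use nn in linarith)
  have l4: "(a2 + d1) + (b2 + e1) + (c2 + f1) = int s"
    by (rule int_sum[OF lines(2)[of 2 3, unfolded expand]]; use nn in linarith)
  have l5: "(a3 + d1) + (b3 + e1) + (c3 + f1) = int s"
    by (rule int_sum[OF lines(2)[of 3 2, unfolded expand]]; use nn in linarith)
  have l6: "(a1 + d2) + (b1 + e2) + (c1 + f2) = int s"
    by (rule int_sum[OF lines(2)[of 3 3, unfolded expand]]; use nn in linarith)
  have l7: "(a1 + d3) + (b1 + e3) + (c1 + f3) = int s"
    by (rule int_sum[OF lines(2)[of 2 2, unfolded expand]]; use nn in linarith)
  note rows = l0 l1 l2 and cols = l3 l4 l5 l6 l7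
  define m where "m = a1 + b1 + c1"
  define x where "x = a1 + a2 + a3 - m"
  define y where "y = b1 + b2 + b3 - m"
  have colm: "a1 + b1 + c1 = m" "a2 + b2 + c2 = m" "a3 + b3 + c3 = m"
    "d1 + e1 + f1 = int s - m" "d2 + e2 + f2 = int s - m" "d3 + e3 + f3 = int s - m"
    using cols by (simp_all add: m_def)
  have hz: "has_zero (a1, a2, a3)" "has_zero (b1, b2, b3)" "has_zero (c1, c2, c3)"
    using ad be cf by (simp_all add: t)
  have le2: "u + v + w \<le> 2 * m" if "has_zero (u, v, w)" "u \<le> m" "v \<le> m" "w \<le> m" for u v w
    using that by (auto simp: has_zero_def)
  have le: "a1 + a2 + a3 \<le> 2 * m" "b1 + b2 + b3 \<le> 2 * m" "c1 + c2 + c3 \<le> 2 * m"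
    by (rule le2[OF hz(1)] le2[OF hz(2)] le2[OF hz(3)]; use nn colm in linarith)+
  have "((a, b, c), (d, e, f)) \<in> pieces s (m, x, y)"
    unfolding pieces_def prod.case mem_Times_iff fst_conv snd_conv t t' tables_def comp3_def
      mem_Collect_eq
    by (simp only: simp_thms hz nn)
      (intro conjI; use colm rows x_def y_def in linarith)
  moreover have "(m, x, y) \<in> index_set s"
  proof -
    have "0 \<le> m" "m \<le> int s" "\<bar>x\<bar> \<le> m" "\<bar>y\<bar> \<le> m"
      using le nn colm by (simp_all add: x_def y_def abs_le_iff)
    moreover have "x + y = m - (c1 + c2 + c3)"
      using colm by (simp add: x_def y_def)
    then have "\<bar>x + y\<bar> \<le> m"
      using le(3) nn by (simp add: abs_le_iff)
    ultimately show ?thesis by (simp add: index_set_def)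
  qed
  ultimately show ?thesis
    unfolding Aeq by (intro image_eqI[where x = "((m, x, y), ((a, b, c), (d, e, f)))"]) auto
qed

lemma finite_index_set: "finite (index_set s)"
  by (rule finite_subset[of _ "{0..int s} \<times> {-int s..int s} \<times> {-int s..int s}"])
    (auto simp: index_set_def)

lemma SH33_sum_tables:
  "real (SH33 s) = (\<Sum>(m, x, y)\<in>index_set s. ntab True True True (m + x) (m + y) (m - x - y) m *
     nfree (int s - m - x) (int s - m - y) (int s - m + x + y) (int s - m))"
proof -
  have "(\<lambda>(i, p). cube_of p) ` Sigma (index_set s) (pieces s) = {A. semi_magic_cube s A}"
    using cube_of_semi_magic cube_of_surj by fast
  then have "bij_betw (\<lambda>(i, p). cube_of p)
      (Sigma (index_set s) (pieces s)) {A. semi_magic_cube s A}"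
    using inj_cube_of by (simp add: bij_betw_def)
  then have "SH33 s = card (Sigma (index_set s) (pieces s))"
    by (simp add: SH33_def bij_betw_same_card)
  also have "\<dots> = (\<Sum>i\<in>index_set s. card (pieces s i))"
    by (rule card_SigmaI) (auto simp: finite_index_set pieces_def finite_tables)
  finally show ?thesis
    by (auto simp: pieces_def ntab_def card_cartesian_product intro!: sum.cong)
qed

section \<open>Summation over hexagons\<close>

lemma sum_split_sign:
  fixes f :: "'a \<Rightarrow> real" and c :: "'a \<Rightarrow> int"
  assumes "finite A"
  shows "sum f A = sum f {p \<in> A. 0 < c p} + sum f {p \<in> A. c p = 0} + sum f {p \<in> A. c p < 0}"
proof -
  have "sum f A = sum f {p \<in> A. 0 < c p} + sum f {p \<in> A. \<not> 0 < c p}"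
    using assms by (subst sum.union_disjoint[symmetric]) (auto intro!: sum.cong)
  also have "sum f {p \<in> A. \<not> 0 < c p} = sum f {p \<in> A. c p = 0} + sum f {p \<in> A. c p < 0}"
    using assms by (subst sum.union_disjoint[symmetric]) (auto intro!: sum.cong)
  finally show ?thesis by simp
qed

definition hexagon :: "nat \<Rightarrow> (int \<times> int) set" where
  "hexagon N = {(x, y). \<bar>x\<bar> \<le> int N \<and> \<bar>y\<bar> \<le> int N \<and> \<bar>x + y\<bar> \<le> int N}"

lemma finite_hexagon: "finite (hexagon N)"
  by (rule finite_subset[of _ "{-int N..int N} \<times> {-int N..int N}"]) (auto simp: hexagon_def)

text \<open>Apart from the centre, the hexagon consists of six rays and six open sectors. Three
  sectors have one positive coordinate among \<open>x\<close>, \<open>y\<close>,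
  \<open>- x - y\<close> and three have two; permuting coordinates identifies the sectors of each
  kind. \<open>D\<close> is the largest absolute value of the three.\<close>

lemma sum_hexagon:
  fixes g :: "int \<Rightarrow> int \<Rightarrow> int \<Rightarrow> real"
  assumes sym12: "\<And>x y z. g x y z = g y x z" and sym23: "\<And>x y z. g x y z = g x z y"
  shows "(\<Sum>(x, y)\<in>hexagon N. g x y (- x - y)) = g 0 0 0
    + (\<Sum>D\<in>{1..N}. 6 * g (int D) (- int D) 0 + 3 * (\<Sum>a\<in>{1..<D}.
        g (int D) (- int a) (- (int D - int a)) + g (int a) (int D - int a) (- int D)))"
proof -
  define f where "f = (\<lambda>(x, y). g x y (- x - y))"
  let ?H = "hexagon N" and ?T = "Sigma {1..N} (\<lambda>D. {1..<D})"
  have f_eq: "f (x, y) = g x y z" "f (x, y) = g x z y" "f (x, y) = g y x z"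
    "f (x, y) = g y z x" "f (x, y) = g z x y" "f (x, y) = g z y x" if "x + y + z = 0" for x y z
  proof -
    have "z = - x - y" using that by simp
    then show "f (x, y) = g x y z" by (simp add: f_def)
    then show "f (x, y) = g x z y" "f (x, y) = g y x z" "f (x, y) = g y z x"
      "f (x, y) = g z x y" "f (x, y) = g z y x"
      by (metis sym12 sym23)+
  qed
  have "bij_betw (\<lambda>(D, a). (int a, int D - int a)) ?T {p \<in> ?H. 0 < fst p \<and> 0 < snd p}"
    by (rule bij_betwI[where g = "\<lambda>(x, y). (nat (x + y), nat x)"]) (auto simp: hexagon_def)
  then have "sum f {p \<in> ?H. 0 < fst p \<and> 0 < snd p} = (\<Sum>(D, a)\<in>?T. f (int a, int D - int a))"
    by (subst sum.reindex_bij_betw[symmetric]) (auto intro!: sum.cong)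
  also have "\<dots> = (\<Sum>(D, a)\<in>?T. g (int a) (int D - int a) (- int D))"
    by (intro sum.cong refl) (auto intro: f_eq)
  finally have tri1: "sum f {p \<in> ?H. 0 < fst p \<and> 0 < snd p}
      = (\<Sum>D\<in>{1..N}. \<Sum>a\<in>{1..<D}. g (int a) (int D - int a) (- int D))"
    by (simp add: sum.Sigma)
  have "bij_betw (\<lambda>(D, a). (int D, - int a)) ?T {p \<in> ?H. 0 < fst p \<and> snd p < 0 \<and> 0 < fst p + snd p}"
    by (rule bij_betwI[where g = "\<lambda>(x, y). (nat x, nat (- y))"]) (auto simp: hexagon_def)
  then have "sum f {p \<in> ?H. 0 < fst p \<and> snd p < 0 \<and> 0 < fst p + snd p}
      = (\<Sum>(D, a)\<in>?T. f (int D, - int a))"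
    by (subst sum.reindex_bij_betw[symmetric]) (auto intro!: sum.cong)
  also have "\<dots> = (\<Sum>(D, a)\<in>?T. g (int D) (- int a) (- (int D - int a)))"
    by (intro sum.cong refl) (auto intro: f_eq)
  finally have tri2: "sum f {p \<in> ?H. 0 < fst p \<and> snd p < 0 \<and> 0 < fst p + snd p}
      = (\<Sum>D\<in>{1..N}. \<Sum>a\<in>{1..<D}. g (int D) (- int a) (- (int D - int a)))"
    by (simp add: sum.Sigma)
  have "bij_betw (\<lambda>(D, a). (int a, - int D)) ?T {p \<in> ?H. 0 < fst p \<and> snd p < 0 \<and> fst p + snd p < 0}"
    by (rule bij_betwI[where g = "\<lambda>(x, y). (nat (- y), nat x)"]) (auto simp: hexagon_def)
  then have "sum f {p \<in> ?H. 0 < fst p \<and> snd p < 0 \<and> fst p + snd p < 0}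
      = (\<Sum>(D, a)\<in>?T. f (int a, - int D))"
    by (subst sum.reindex_bij_betw[symmetric]) (auto intro!: sum.cong)
  also have "\<dots> = (\<Sum>(D, a)\<in>?T. g (int a) (int D - int a) (- int D))"
    by (intro sum.cong refl) (auto intro: f_eq)
  finally have tri3: "sum f {p \<in> ?H. 0 < fst p \<and> snd p < 0 \<and> fst p + snd p < 0}
      = (\<Sum>D\<in>{1..N}. \<Sum>a\<in>{1..<D}. g (int a) (int D - int a) (- int D))"
    by (simp add: sum.Sigma)
  have "bij_betw (\<lambda>(D, a). (- int a, - (int D - int a))) ?T {p \<in> ?H. fst p < 0 \<and> snd p < 0}"
    by (rule bij_betwI[where g = "\<lambda>(x, y). (nat (- x - y), nat (- x))"]) (auto simp: hexagon_def)
  then have "sum f {p \<in> ?H. fst p < 0 \<and> snd p < 0} = (\<Sum>(D, a)\<in>?T. f (- int a, - (int D - int a)))"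
    by (subst sum.reindex_bij_betw[symmetric]) (auto intro!: sum.cong)
  also have "\<dots> = (\<Sum>(D, a)\<in>?T. g (int D) (- int a) (- (int D - int a)))"
    by (intro sum.cong refl) (auto intro: f_eq)
  finally have tri4: "sum f {p \<in> ?H. fst p < 0 \<and> snd p < 0}
      = (\<Sum>D\<in>{1..N}. \<Sum>a\<in>{1..<D}. g (int D) (- int a) (- (int D - int a)))"
    by (simp add: sum.Sigma)
  have "bij_betw (\<lambda>(D, a). (- int a, int D)) ?T {p \<in> ?H. fst p < 0 \<and> 0 < snd p \<and> 0 < fst p + snd p}"
    by (rule bij_betwI[where g = "\<lambda>(x, y). (nat y, nat (- x))"]) (auto simp: hexagon_def)
  then have "sum f {p \<in> ?H. fst p < 0 \<and> 0 < snd p \<and> 0 < fst p + snd p}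
      = (\<Sum>(D, a)\<in>?T. f (- int a, int D))"
    by (subst sum.reindex_bij_betw[symmetric]) (auto intro!: sum.cong)
  also have "\<dots> = (\<Sum>(D, a)\<in>?T. g (int D) (- int a) (- (int D - int a)))"
    by (intro sum.cong refl) (auto intro: f_eq)
  finally have tri5: "sum f {p \<in> ?H. fst p < 0 \<and> 0 < snd p \<and> 0 < fst p + snd p}
      = (\<Sum>D\<in>{1..N}. \<Sum>a\<in>{1..<D}. g (int D) (- int a) (- (int D - int a)))"
    by (simp add: sum.Sigma)
  have "bij_betw (\<lambda>(D, a). (- int D, int a)) ?T {p \<in> ?H. fst p < 0 \<and> 0 < snd p \<and> fst p + snd p < 0}"
    by (rule bij_betwI[where g = "\<lambda>(x, y). (nat (- x), nat y)"]) (auto simp: hexagon_def)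
  then have "sum f {p \<in> ?H. fst p < 0 \<and> 0 < snd p \<and> fst p + snd p < 0}
      = (\<Sum>(D, a)\<in>?T. f (- int D, int a))"
    by (subst sum.reindex_bij_betw[symmetric]) (auto intro!: sum.cong)
  also have "\<dots> = (\<Sum>(D, a)\<in>?T. g (int a) (int D - int a) (- int D))"
    by (intro sum.cong refl) (auto intro: f_eq)
  finally have tri6: "sum f {p \<in> ?H. fst p < 0 \<and> 0 < snd p \<and> fst p + snd p < 0}
      = (\<Sum>D\<in>{1..N}. \<Sum>a\<in>{1..<D}. g (int a) (int D - int a) (- int D))"
    by (simp add: sum.Sigma)
  have "bij_betw (\<lambda>D. (int D, 0)) {1..N} {p \<in> ?H. 0 < fst p \<and> snd p = 0}"
    by (rule bij_betwI[where g = "\<lambda>(x, y). nat x"]) (auto simp: hexagon_def)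
  then have "sum f {p \<in> ?H. 0 < fst p \<and> snd p = 0} = (\<Sum>D\<in>{1..N}. f (int D, 0))"
    by (subst sum.reindex_bij_betw[symmetric]) auto
  also have "\<dots> = (\<Sum>D\<in>{1..N}. g (int D) (- int D) 0)"
    by (intro sum.cong refl) (auto intro: f_eq)
  finally have line1: "sum f {p \<in> ?H. 0 < fst p \<and> snd p = 0} = (\<Sum>D\<in>{1..N}. g (int D) (- int D) 0)" .
  have "bij_betw (\<lambda>D. (int D, - int D)) {1..N} {p \<in> ?H. 0 < fst p \<and> snd p < 0 \<and> fst p + snd p = 0}"
    by (rule bij_betwI[where g = "\<lambda>(x, y). nat x"]) (auto simp: hexagon_def)
  then have "sum f {p \<in> ?H. 0 < fst p \<and> snd p < 0 \<and> fst p + snd p = 0}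
      = (\<Sum>D\<in>{1..N}. f (int D, - int D))"
    by (subst sum.reindex_bij_betw[symmetric]) auto
  also have "\<dots> = (\<Sum>D\<in>{1..N}. g (int D) (- int D) 0)"
    by (intro sum.cong refl) (auto intro: f_eq)
  finally have line2: "sum f {p \<in> ?H. 0 < fst p \<and> snd p < 0 \<and> fst p + snd p = 0}
      = (\<Sum>D\<in>{1..N}. g (int D) (- int D) 0)" .
  have "bij_betw (\<lambda>D. (0, int D)) {1..N} {p \<in> ?H. fst p = 0 \<and> 0 < snd p}"
    by (rule bij_betwI[where g = "\<lambda>(x, y). nat y"]) (auto simp: hexagon_def)
  then have "sum f {p \<in> ?H. fst p = 0 \<and> 0 < snd p} = (\<Sum>D\<in>{1..N}. f (0, int D))"
    by (subst sum.reindex_bij_betw[symmetric]) auto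
  also have "\<dots> = (\<Sum>D\<in>{1..N}. g (int D) (- int D) 0)"
    by (intro sum.cong refl) (auto intro: f_eq)
  finally have line3: "sum f {p \<in> ?H. fst p = 0 \<and> 0 < snd p} = (\<Sum>D\<in>{1..N}. g (int D) (- int D) 0)" .
  have "bij_betw (\<lambda>D. (0, - int D)) {1..N} {p \<in> ?H. fst p = 0 \<and> snd p < 0}"
    by (rule bij_betwI[where g = "\<lambda>(x, y). nat (- y)"]) (auto simp: hexagon_def)
  then have "sum f {p \<in> ?H. fst p = 0 \<and> snd p < 0} = (\<Sum>D\<in>{1..N}. f (0, - int D))"
    by (subst sum.reindex_bij_betw[symmetric]) auto
  also have "\<dots> = (\<Sum>D\<in>{1..N}. g (int D) (- int D) 0)"
    by (intro sum.cong refl) (auto intro: f_eq)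
  finally have line4: "sum f {p \<in> ?H. fst p = 0 \<and> snd p < 0} = (\<Sum>D\<in>{1..N}. g (int D) (- int D) 0)" .
  have "bij_betw (\<lambda>D. (- int D, 0)) {1..N} {p \<in> ?H. fst p < 0 \<and> snd p = 0}"
    by (rule bij_betwI[where g = "\<lambda>(x, y). nat (- x)"]) (auto simp: hexagon_def)
  then have "sum f {p \<in> ?H. fst p < 0 \<and> snd p = 0} = (\<Sum>D\<in>{1..N}. f (- int D, 0))"
    by (subst sum.reindex_bij_betw[symmetric]) auto
  also have "\<dots> = (\<Sum>D\<in>{1..N}. g (int D) (- int D) 0)"
    by (intro sum.cong refl) (auto intro: f_eq)
  finally have line5: "sum f {p \<in> ?H. fst p < 0 \<and> snd p = 0} = (\<Sum>D\<in>{1..N}. g (int D) (- int D) 0)" .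
  have "bij_betw (\<lambda>D. (- int D, int D)) {1..N} {p \<in> ?H. fst p < 0 \<and> 0 < snd p \<and> fst p + snd p = 0}"
    by (rule bij_betwI[where g = "\<lambda>(x, y). nat y"]) (auto simp: hexagon_def)
  then have "sum f {p \<in> ?H. fst p < 0 \<and> 0 < snd p \<and> fst p + snd p = 0}
      = (\<Sum>D\<in>{1..N}. f (- int D, int D))"
    by (subst sum.reindex_bij_betw[symmetric]) auto
  also have "\<dots> = (\<Sum>D\<in>{1..N}. g (int D) (- int D) 0)"
    by (intro sum.cong refl) (auto intro: f_eq)
  finally have line6: "sum f {p \<in> ?H. fst p < 0 \<and> 0 < snd p \<and> fst p + snd p = 0}
      = (\<Sum>D\<in>{1..N}. g (int D) (- int D) 0)" .
  have "sum f ?H = sum f {p \<in> ?H. 0 < fst p} + sum f {p \<in> ?H. fst p = 0}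
      + sum f {p \<in> ?H. fst p < 0}"
    by (rule sum_split_sign) (rule finite_hexagon)
  also have "sum f {p \<in> ?H. fst p = 0} = sum f {p \<in> ?H. fst p = 0 \<and> 0 < snd p}
      + sum f {p \<in> ?H. fst p = 0 \<and> snd p = 0} + sum f {p \<in> ?H. fst p = 0 \<and> snd p < 0}"
    by (subst sum_split_sign[where c = snd]) (auto simp: finite_hexagon conj_assoc)
  also have "{p \<in> ?H. fst p = 0 \<and> snd p = 0} = {(0, 0)}"
    by (auto simp: hexagon_def)
  also have "sum f {p \<in> ?H. 0 < fst p} = sum f {p \<in> ?H. 0 < fst p \<and> 0 < snd p}
      + sum f {p \<in> ?H. 0 < fst p \<and> snd p = 0} + sum f {p \<in> ?H. 0 < fst p \<and> snd p < 0}"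
    by (subst sum_split_sign[where c = snd]) (auto simp: finite_hexagon conj_assoc)
  also have "sum f {p \<in> ?H. 0 < fst p \<and> snd p < 0}
      = sum f {p \<in> ?H. 0 < fst p \<and> snd p < 0 \<and> 0 < fst p + snd p}
      + sum f {p \<in> ?H. 0 < fst p \<and> snd p < 0 \<and> fst p + snd p = 0}
      + sum f {p \<in> ?H. 0 < fst p \<and> snd p < 0 \<and> fst p + snd p < 0}"
    by (subst sum_split_sign[where c = "\<lambda>p. fst p + snd p"]) (auto simp: finite_hexagon conj_assoc)
  also have "sum f {p \<in> ?H. fst p < 0} = sum f {p \<in> ?H. fst p < 0 \<and> 0 < snd p}
      + sum f {p \<in> ?H. fst p < 0 \<and> snd p = 0} + sum f {p \<in> ?H. fst p < 0 \<and> snd p < 0}"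
    by (subst sum_split_sign[where c = snd]) (auto simp: finite_hexagon conj_assoc)
  also have "sum f {p \<in> ?H. fst p < 0 \<and> 0 < snd p}
      = sum f {p \<in> ?H. fst p < 0 \<and> 0 < snd p \<and> 0 < fst p + snd p}
      + sum f {p \<in> ?H. fst p < 0 \<and> 0 < snd p \<and> fst p + snd p = 0}
      + sum f {p \<in> ?H. fst p < 0 \<and> 0 < snd p \<and> fst p + snd p < 0}"
    by (subst sum_split_sign[where c = "\<lambda>p. fst p + snd p"]) (auto simp: finite_hexagon conj_assoc)
  also note tri1 also note tri2 also note tri3 also note tri4 also note tri5 also note tri6
  also note line1 also note line2 also note line3 also note line4 also note line5 also note line6
  finally have "sum f ?H = g 0 0 0 + 6 * (\<Sum>D\<in>{1..N}. g (int D) (- int D) 0)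
      + 3 * ((\<Sum>D\<in>{1..N}. \<Sum>a\<in>{1..<D}. g (int D) (- int a) (- (int D - int a)))
        + (\<Sum>D\<in>{1..N}. \<Sum>a\<in>{1..<D}. g (int a) (int D - int a) (- int D)))"
    by (simp add: f_def)
  then show ?thesis
    by (simp add: f_def sum.distrib sum_distrib_left algebra_simps)
qed

section \<open>From hexagons to rings of fixed norm\<close>

definition center_weight :: "nat \<Rightarrow> real" where "center_weight n
    = 15 * real n - 9 + (if n = 0 then 10 else 0)"
definition axis_weight :: "nat \<Rightarrow> real" where "axis_weight n
    = 15 * real n - 3 + (if n = 0 then 6 else 0)"
definition peak_weight :: "nat \<Rightarrow> real" where "peak_weight n
    = 12 * real n + (if n = 0 then 3 else 0)"
definition dent_weight :: "nat \<Rightarrow> real" where "dent_weight n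
    = 18 * real n + (if n = 0 then 6 else 0)"

text \<open>\<open>c = s - m\<close> is the column sum of the second table and
  \<open>n = m - D\<close>. Complementary row sums have negated deviations, so a peak in one table
  faces a dent in the other; hence the crossed products.\<close>

definition ring_sum :: "nat \<Rightarrow> nat \<Rightarrow> nat \<Rightarrow> real" where
  "ring_sum D c n = 6 * axis_weight n * peak_count (int c) (int D) 0
     + 3 * (\<Sum>a\<in>{1..<D}. peak_weight n * dent_count (int c) (int a) (int D - int a)
         + dent_weight n * peak_count (int c) (int a) (int D - int a))"

lemma layer_sum:
  assumes "m \<le> s"
  shows "(\<Sum>(x, y)\<in>hexagon m. ntab True True True (int m + x) (int m + y) (int m - x - y) (int m) *
       nfree (int s - int m - x) (int s - int m - y) (int s - int m + x + y) (int s - int m))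
     = center_weight m * peak_count (int (s - m)) 0 0 + (\<Sum>D\<in>{1..m}. ring_sum D (s - m) (m - D))"
proof -
  define c where "c = int (s - m)"
  have c: "int s - int m = c" using assms by (simp add: c_def of_nat_diff)
  define g where "g x y z = ntab True True True (int m + x) (int m + y) (int m + z) (int m) *
    nfree (c - x) (c - y) (c - z) c" for x y z
  have sym12: "g x y z = g y x z" for x y z
    unfolding g_def by (subst ntab_swap12, subst (2) ntab_swap12) simp
  have sym23: "g x y z = g x z y" for x y z
    unfolding g_def by (subst ntab_swap23, subst (2) ntab_swap23) simp
  have "g 0 0 0 = center_weight m * peak_count c 0 0"
    using ntab_zero_rows_center[of "int m" "int m"] nfree_peak(1)[of 0 0 c] by
        (simp add: g_def center_weight_def)
  moreover have rings: "6 * g (int D) (- int D) 0 + 3 * (\<Sum>a\<in>{1..<D}.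
        g (int D) (- int a) (- (int D - int a)) + g (int a) (int D - int a) (- int D))
      = ring_sum D (s - m) (m - D)" if D: "D \<in> {1..m}" for D
  proof -
    have D': "0 \<le> int (m - D)" "1 \<le> int D" "int m = int (m - D) + int D"
      using D by auto
    have "g (int D) (- int D) 0 = ntab True True True (int m + int D) (int m - int D) (int m)
        (int m)
        * nfree (c - int D) (c + int D + 0) (c - 0) c"
      by (simp add: g_def)
    then have 1: "g (int D) (- int D) 0 = axis_weight (m - D) * peak_count c (int D) 0"
      using nfree_peak(2)[of "int D" 0 c] by (simp add: ntab_zero_rows_axis[OF D'] axis_weight_def)
    have ab: "1 \<le> int a" "1 \<le> int D - int a" "int m = int (m - D) + int a + (int D - int a)"
      if "a \<in> {1..<D}" for a
      using that D by auto
    have ab': "-1 \<le> int a" "-1 \<le> int D - int a" "-1 \<le> int a + (int D - int a)"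
      if "a \<in> {1..<D}" for a
      using that by auto
    have 2: "g (int D) (- int a) (- (int D - int a))
        = peak_weight (m - D) * dent_count c (int a) (int D - int a)"
      if "a \<in> {1..<D}" for a
    proof -
      have "g (int D) (- int a) (- (int D - int a))
          = ntab True True True (int m + int a + (int D - int a)) (int m - int a)
              (int m - (int D - int a)) (int m)
            * nfree (c - int a - (int D - int a)) (c + int a) (c + (int D - int a)) c"
        by (simp add: g_def algebra_simps)
      also have "\<dots> = peak_weight (m - D) * dent_count c (int a) (int D - int a)"
        unfolding ntab_zero_rows_peak[OF D'(1) ab[OF that]] nfree_dent(1)[OF ab'[OF that]]
        by (simp add: peak_weight_def)
      finally show ?thesis .
    qed
    have 3: "g (int a) (int D - int a) (- int D)
        = dent_weight (m - D) * peak_count c (int a) (int D - int a)"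
      if "a \<in> {1..<D}" for a
    proof -
      have "g (int a) (int D - int a) (- int D)
          = ntab True True True (int m + int a) (int m + (int D - int a))
              (int m - int a - (int D - int a)) (int m)
            * nfree (c - int a) (c - (int D - int a)) (c + int a + (int D - int a)) c"
        by (simp add: g_def algebra_simps)
      also have "\<dots> = dent_weight (m - D) * peak_count c (int a) (int D - int a)"
        unfolding ntab_zero_rows_dent[OF D'(1) ab[OF that]] nfree_peak(3)[OF ab'[OF that]]
        by (simp add: dent_weight_def)
      finally show ?thesis .
    qed
    have "(\<Sum>a\<in>{1..<D}. g (int D) (- int a) (- (int D - int a))
        + g (int a) (int D - int a) (- int D))
        = (\<Sum>a\<in>{1..<D}. peak_weight (m - D) * dent_count c (int a) (int D - int a)
          + dent_weight (m - D) * peak_count c (int a) (int D - int a))"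
      by (rule sum.cong[OF refl]) (simp only: 2 3)
    then show ?thesis unfolding ring_sum_def 1 c_def[symmetric] by simp
  qed
  ultimately have "(\<Sum>(x, y)\<in>hexagon m. g x y (- x - y))
      = center_weight m * peak_count c 0 0 + (\<Sum>D\<in>{1..m}. ring_sum D (s - m) (m - D))"
    using sum_hexagon[of g m, OF sym12 sym23] by (simp only: sum.cong[OF refl rings])
  moreover have "(\<Sum>(x, y)\<in>hexagon m. g x y (- x - y))
      = (\<Sum>(x, y)\<in>hexagon m. ntab True True True (int m + x) (int m + y) (int m - x - y) (int m) *
         nfree (c - x) (c - y) (c + x + y) c)"
    by (rule sum.cong) (auto simp: g_def algebra_simps)
  ultimately show ?thesis by (simp only: c flip: c_def)
qed

lemma SH33_sum_layers:
  "real (SH33 s) = (\<Sum>m\<le>s. center_weight m * peak_count (int (s - m)) 0 0)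
     + (\<Sum>m\<le>s. \<Sum>D\<in>{1..m}. ring_sum D (s - m) (m - D))"
proof -
  let ?F = "\<lambda>m x y. ntab True True True (m + x) (m + y) (m - x - y) m *
     nfree (int s - m - x) (int s - m - y) (int s - m + x + y) (int s - m)"
  have "bij_betw (\<lambda>(k, x, y). (int k, x, y)) (Sigma {..s} hexagon) (index_set s)"
    by (rule bij_betwI[where g = "\<lambda>(m, x, y). (nat m, x, y)"])
        (auto simp: index_set_def hexagon_def)
  then have "real (SH33 s) = (\<Sum>(k, p)\<in>Sigma {..s} hexagon. case p of (x, y) \<Rightarrow> ?F (int k) x y)"
    unfolding SH33_sum_tables
    by (subst sum.reindex_bij_betw[symmetric]) (auto intro!: sum.cong)
  also have "\<dots> = (\<Sum>k\<le>s. \<Sum>(x, y)\<in>hexagon k. ?F (int k) x y)"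
    by (subst sum.Sigma) (auto simp: finite_hexagon)
  also have "\<dots> = (\<Sum>m\<le>s. center_weight m * peak_count (int (s - m)) 0 0
      + (\<Sum>D\<in>{1..m}. ring_sum D (s - m) (m - D)))"
    by (rule sum.cong) (simp_all add: layer_sum)
  finally show ?thesis by (simp add: sum.distrib)
qed

section \<open>Rings whose norm exceeds the column sum of the second table\<close>

definition binom5 :: "real \<Rightarrow> real" where
  "binom5 x = x * (x - 1) * (x - 2) * (x - 3) * (x - 4) / 120"

text \<open>Both sides count compositions of \<open>e\<close> into six parts.\<close>

lemma sum_ncomp3_convolution:
  "(\<Sum>i\<le>e. ncomp3 (int i) * ncomp3 (int e - int i)) = binom5 (real e + 5)"
proof -
  \<comment> \<open>\<open>e\<close> is both the upper limit and a parameter of the summand;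
    induction on the limit works once the parameter is a separate real \<open>r\<close>.\<close>
  have gen: "(\<Sum>i\<le>k. (real i^2 * r^2 - 2 * real i^3 * r + real i^4 + 3 * real i * r^2
      - 3 * real i^2 * r + 5 * real i * r - 5 * real i^2 + 2 * r^2 + 6 * r + 4) / 4)
    = (10 * real k^3 * r^2 - 15 * real k^4 * r + 6 * real k^5 + 60 * real k^2 * r^2
        - 60 * real k^3 * r + 15 * real k^4 + 110 * real k * r^2 + 15 * real k^2 * r
        - 40 * real k^3 + 240 * real k * r - 75 * real k^2 + 60 * r^2 + 94 * real k + 180 * r
        + 120) / 120" for r k
    by (induction k) (auto simp: field_simps power_numeral_reduce)
  have "(\<Sum>i\<le>e. ncomp3 (int i) * ncomp3 (int e - int i))
      = (\<Sum>i\<le>e. (real i^2 * real e^2 - 2 * real i^3 * real e + real i^4 + 3 * real i * real e^2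
      - 3 * real i^2 * real e + 5 * real i * real e - 5 * real i^2 + 2 * real e^2 + 6 * real e
      + 4) / 4)"
  proof (rule sum.cong)
    fix i assume "i \<in> {..e}"
    then have "ncomp3 (int i) * ncomp3 (int e - int i)
        = (real i + 1) * (real i + 2) / 2 * ((real e - real i + 1) * (real e - real i + 2) / 2)"
      by (simp add: ncomp3_def)
    also have "\<dots> = (real i^2 * real e^2 - 2 * real i^3 * real e + real i^4
        + 3 * real i * real e^2 - 3 * real i^2 * real e + 5 * real i * real e - 5 * real i^2
        + 2 * real e^2 + 6 * real e + 4) / 4"
      by (simp add: field_simps power_numeral_reduce)
    finally show "ncomp3 (int i) * ncomp3 (int e - int i)
        = (real i^2 * real e^2 - 2 * real i^3 * real e + real i^4 + 3 * real i * real e^2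
        - 3 * real i^2 * real e + 5 * real i * real e - 5 * real i^2 + 2 * real e^2 + 6 * real e
        + 4) / 4" .
  qed simp
  also have "\<dots> = binom5 (real e + 5)"
    unfolding gen by (simp add: binom5_def field_simps power_numeral_reduce)
  finally show ?thesis .
qed

text \<open>
  The weight \<open>dent_weight n\<close> is the difference of \<open>3 * (n + 1) * (n + 2)\<close> at \<open>n\<close> and \<open>n - 3\<close> (the
  latter read as 0 for \<open>n < 3\<close>); this telescoping is what prevents a period 3 in the final formula.
\<close>
lemma sum_dent_weight_step3:
  "3 * k \<le> q \<Longrightarrow> q < 3 * k + 3 \<Longrightarrow> (\<Sum>i\<le>k. dent_weight (q - 3 * i)) = 3 * (real q + 1) * (real q + 2)"
proof (induction k arbitrary: q)
  case 0
  then consider "q = 0" | "q = 1" | "q = 2" by linarith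
  then show ?case by cases (auto simp: dent_weight_def)
next
  case (Suc k)
  have "(\<Sum>i\<le>Suc k. dent_weight (q - 3 * i)) = dent_weight q + (\<Sum>i\<le>k. dent_weight (q - 3 - 3 * i))"
    by (subst sum.atMost_Suc_shift) (simp add: algebra_simps)
  also have "(\<Sum>i\<le>k. dent_weight (q - 3 - 3 * i)) = 3 * (real (q - 3) + 1) * (real (q - 3) + 2)"
    using Suc.prems by (intro Suc.IH) auto
  finally show ?case using Suc.prems by (simp add: dent_weight_def of_nat_diff field_simps)
qed

text \<open>For \<open>c < D\<close> a dent in the second table would have a row of negative sum,
  and so would a point on a ray. Only its peaks survive, and their correction term vanishes, which
  leaves a pure convolution.\<close>

lemma ring_sum_outer:
  assumes "c < D"
  shows "ring_sum D c n = (if D \<le> 2 * c then 3 * dent_weight n * binom5 (2 * real c - real D + 5)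
      else 0)"
proof -
  have "peak_count (int c) (int D) 0 = 0" "dent_count (int c) (int a) (int D - int a) = 0"
    "peak_count (int c) (int a) (int D - int a)
        = ncomp3 (int c - int a) * ncomp3 (int c - int D + int a)" for a
    using assms by (simp_all add: peak_count_def dent_count_def ncomp3_neg algebra_simps)
  then have eq: "ring_sum D c n = 3 * dent_weight n
      * (\<Sum>a\<in>{1..<D}. ncomp3 (int c - int a) * ncomp3 (int c - int D + int a))"
    by (simp add: ring_sum_def sum_distrib_left mult_ac)
  have "(\<Sum>a\<in>{1..<D}. ncomp3 (int c - int a) * ncomp3 (int c - int D + int a))
      = (\<Sum>a\<in>{a. D \<le> c + a \<and> a \<le> c}. ncomp3 (int c - int a) * ncomp3 (int c - int D + int a))"
    using assms by (intro sum.mono_neutral_right) (auto simp: ncomp3_def)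
  also have "\<dots> = (if D \<le> 2 * c then binom5 (2 * real c - real D + 5) else 0)"
  proof (cases "D \<le> 2 * c")
    case True
    have "bij_betw (\<lambda>i. c - i) {..2 * c - D} {a. D \<le> c + a \<and> a \<le> c}"
      by (rule bij_betwI[where g = "\<lambda>a. c - a"]) (use True assms in auto)
    then have "(\<Sum>a\<in>{a. D \<le> c + a \<and> a \<le> c}. ncomp3 (int c - int a) * ncomp3 (int c - int D + int a))
        = (\<Sum>i\<le>2 * c - D. ncomp3 (int c - int (c - i)) * ncomp3 (int c - int D + int (c - i)))"
      by (subst sum.reindex_bij_betw[symmetric]) auto
    also have "\<dots> = (\<Sum>i\<le>2 * c - D. ncomp3 (int i) * ncomp3 (int (2 * c - D) - int i))"
      using True assms by (intro sum.cong) (auto simp: of_nat_diff algebra_simps)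
    also have "\<dots> = binom5 (real (2 * c - D) + 5)"
      by (rule sum_ncomp3_convolution)
    finally show ?thesis using True by (simp add: of_nat_diff)
  next
    case False
    then have empty: "{a. D \<le> c + a \<and> a \<le> c} = {}" by auto
    show ?thesis unfolding empty using False by simp
  qed
  finally show ?thesis by (simp add: eq)
qed

lemma sum_ring_outer:
  "(\<Sum>(D, c)\<in>{(D, c). c < D \<and> D + c \<le> s}. ring_sum D c (s - D - c))
    = (\<Sum>j\<in>{1..s div 2}. 9 * (real (s - 2 * j)) * (real (s - 2 * j) + 1) * binom5 (real j + 4))"
proof -
  let ?A = "{(D, c). c < D \<and> D + c \<le> s}"
  have finA: "finite ?A"
    by (rule finite_subset[of _ "{..s} \<times> {..s}"]) auto
  have "(\<Sum>(D, c)\<in>?A. ring_sum D c (s - D - c))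
      = (\<Sum>(D, c)\<in>{(D, c). c < D \<and> D \<le> 2 * c \<and> D + c \<le> s}. 3 * dent_weight (s - D - c) * binom5
          (2 * real c - real D + 5))"
    using finA by (intro sum.mono_neutral_cong_right) (auto simp: ring_sum_outer split: if_splits)
  also have "\<dots> = (\<Sum>(j, i)\<in>Sigma {1..s div 2} (\<lambda>j. {i. 2 * j + 1 + 3 * i \<le> s}).
      3 * dent_weight (s - 2 * j - 1 - 3 * i) * binom5 (real j + 4))"
  proof -
    \<comment> \<open>The substitution is \<open>j = 2 * c - D + 1\<close>,
      \<open>i = D - c - 1\<close>. It fixes the \<open>binom5\<close> factor for each
      \<open>j\<close>, and since \<open>D + c = 2 * j + 3 * i + 1\<close>, the weight argument runs
      down in steps of 3, ready for telescoping.\<close>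
    have "bij_betw (\<lambda>(j, i). (j + 2 * i + 1, j + i))
        (Sigma {1..s div 2} (\<lambda>j. {i. 2 * j + 1 + 3 * i \<le> s}))
            {(D, c). c < D \<and> D \<le> 2 * c \<and> D + c \<le> s}"
      by (rule bij_betwI[where g = "\<lambda>(D, c). (2 * c + 1 - D, D - c - 1)"]) auto
    then show ?thesis
      by (subst sum.reindex_bij_betw[symmetric])
        (auto intro!: sum.cong simp: algebra_simps diff_diff_eq)
  qed
  also have "\<dots> = (\<Sum>j\<in>{1..s div 2}. \<Sum>i\<in>{i. 2 * j + 1 + 3 * i \<le> s}. 3 * dent_weight
      (s - 2 * j - 1 - 3 * i) * binom5 (real j + 4))"
    by (subst sum.Sigma) (auto intro: finite_subset[of _ "{..s}"])
  also have "\<dots> = (\<Sum>j\<in>{1..s div 2}. 9 * (real (s - 2 * j)) * (real (s - 2 * j) + 1) * binom5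
      (real j + 4))"
  proof (rule sum.cong)
    fix j assume j: "j \<in> {1..s div 2}"
    show "(\<Sum>i\<in>{i. 2 * j + 1 + 3 * i \<le> s}. 3 * dent_weight (s - 2 * j - 1 - 3 * i) * binom5
        (real j + 4))
      = 9 * (real (s - 2 * j)) * (real (s - 2 * j) + 1) * binom5 (real j + 4)"
    \<comment> \<open>For \<open>s = 2 * j\<close> no \<open>i\<close> is admissible, and the right
      side vanishes through its factor \<open>s - 2 * j\<close>.\<close>
    proof (cases "s = 2 * j")
      case False
      define q where "q = s - 2 * j - 1"
      have q: "s - 2 * j = q + 1" using j False by (auto simp: q_def)
      have "{i. 2 * j + 1 + 3 * i \<le> s} = {..q div 3}" using j False by (auto simp: q_def)
      then have "(\<Sum>i\<in>{i. 2 * j + 1 + 3 * i \<le> s}. 3 * dent_weight (s - 2 * j - 1 - 3 * i) * binom5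
          (real j + 4))
          = 3 * (\<Sum>i\<le>q div 3. dent_weight (q - 3 * i)) * binom5 (real j + 4)"
        by (simp add: q_def sum_distrib_left sum_distrib_right)
      also have "(\<Sum>i\<le>q div 3. dent_weight (q - 3 * i)) = 3 * (real q + 1) * (real q + 2)"
        by (rule sum_dent_weight_step3) auto
      also have "3 * (3 * (real q + 1) * (real q + 2)) * binom5 (real j + 4)
          = 9 * real (s - 2 * j) * (real (s - 2 * j) + 1) * binom5 (real j + 4)"
        unfolding q by (simp add: algebra_simps)
      finally show ?thesis .
    qed simp
  qed simp
  finally show ?thesis .
qed

text \<open>In the first summand \<open>D\<close> is the index \<open>j\<close> of
  \<open>sum_ring_outer\<close>; in the second it is the norm, and \<open>D \<le> c\<close> with
  \<open>D + c \<le> s\<close> forces \<open>D \<le> s div 2\<close>. Equal ranges let both be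
  written as one sum.\<close>

lemma SH33_sum_rings:
  "real (SH33 s) = (\<Sum>m\<le>s. center_weight m * peak_count (int (s - m)) 0 0)
     + (\<Sum>D\<in>{1..s div 2}. 9 * (real (s - 2 * D)) * (real (s - 2 * D) + 1) * binom5 (real D + 4)
         + (\<Sum>e\<le>s - 2 * D. ring_sum D (D + e) (s - 2 * D - e)))"
proof -
  let ?A = "{(D, c). 1 \<le> D \<and> D + c \<le> s}"
  let ?B = "{(D, c). c < D \<and> D + c \<le> s}" and ?C = "{(D, c). 1 \<le> D \<and> D \<le> c \<and> D + c \<le> s}"
  have fin: "finite ?B" "finite ?C"
    by (rule finite_subset[of _ "{..s} \<times> {..s}"]; auto)+
  have "bij_betw (\<lambda>(D, c). (s - c, D)) ?A (Sigma {..s} (\<lambda>m. {1..m}))"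
    by (rule bij_betwI[where g = "\<lambda>(m, D). (D, s - m)"]) auto
  then have reindex: "(\<Sum>(m, D)\<in>Sigma {..s} (\<lambda>m. {1..m}). ring_sum D (s - m) (m - D))
      = (\<Sum>(D, c)\<in>?A. ring_sum D c (s - D - c))"
    by (subst sum.reindex_bij_betw[symmetric])
        (auto intro!: sum.cong simp: diff_diff_eq add.commute)
  have "(\<Sum>m\<le>s. \<Sum>D\<in>{1..m}. ring_sum D (s - m) (m - D)) = (\<Sum>(D, c)\<in>?A. ring_sum D c (s - D - c))"
    unfolding reindex[symmetric] by (rule sum.Sigma) auto
  also have "?A = ?B \<union> ?C" by auto
  also have "(\<Sum>(D, c)\<in>?B \<union> ?C. ring_sum D c (s - D - c))
      = (\<Sum>(D, c)\<in>?B. ring_sum D c (s - D - c)) + (\<Sum>(D, c)\<in>?C. ring_sum D c (s - D - c))"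
    using fin by (intro sum.union_disjoint) auto
  also have "(\<Sum>(D, c)\<in>?C. ring_sum D c (s - D - c))
      = (\<Sum>(D, e)\<in>Sigma {1..s div 2} (\<lambda>D. {..s - 2 * D}). ring_sum D (D + e) (s - 2 * D - e))"
  proof -
    have "bij_betw (\<lambda>(D, e). (D, D + e)) (Sigma {1..s div 2} (\<lambda>D. {..s - 2 * D})) ?C"
      by (rule bij_betwI[where g = "\<lambda>(D, c). (D, c - D)"]) auto
    then show ?thesis
      by (subst sum.reindex_bij_betw[symmetric])
          (auto intro!: sum.cong simp: diff_diff_eq mult_2 add.assoc)
  qed
  also have "\<dots> = (\<Sum>D\<in>{1..s div 2}. \<Sum>e\<le>s - 2 * D. ring_sum D (D + e) (s - 2 * D - e))"
    by (rule sum.Sigma[symmetric]) auto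
  finally show ?thesis
    unfolding SH33_sum_layers sum_ring_outer sum.distrib by (rule arg_cong)
qed

section \<open>Closed forms\<close>

text \<open>The quantities that will be tied to the upper limit are free reals here and in the next
  four lemmas, so that each closed form follows by induction on the limit alone.\<close>

lemma sum_peak_polynomial:
  fixes D e :: real
  shows "(\<Sum>a\<in>{1..<Suc k}. (4 * D * real a * e^2 - 4 * D * real a^2 * e - 4 * D * real a^3
      + 4 * D * e^3 + 4 * D^2 * real a * e + 2 * D^2 * real a^2 + 2 * D^2 * e^2
      - 4 * real a^2 * e^2 + 2 * real a^4 + e^4 + 12 * D * real a * e - 6 * D * real a^2
      + 18 * D * e^2 + 6 * D^2 * real a + 6 * D^2 * e - 12 * real a^2 * e + 6 * e^3
      + 10 * D * real a + 26 * D * e + 4 * D^2 - 10 * real a^2 + 15 * e^2 + 12 * D + 18 * e + 8)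
      / 8)
    = (-20 * D * e * real k^3 + 30 * D * e^2 * real k^2 + 60 * D * e^3 * real k
        - 15 * D * real k^4 + 30 * D^2 * e * real k^2 + 30 * D^2 * e^2 * real k
        + 10 * D^2 * real k^3 - 20 * e^2 * real k^3 + 15 * e^4 * real k + 6 * real k^5
        + 60 * D * e * real k^2 + 300 * D * e^2 * real k - 60 * D * real k^3
        + 120 * D^2 * e * real k + 60 * D^2 * real k^2 - 60 * e * real k^3 - 30 * e^2 * real k^2
        + 90 * e^3 * real k + 15 * real k^4 + 470 * D * e * real k + 15 * D * real k^2
        + 110 * D^2 * real k - 90 * e * real k^2 + 215 * e^2 * real k - 40 * real k^3
        + 240 * D * real k + 240 * e * real k - 75 * real k^2 + 94 * real k) / 120"
  by (induction k) (auto simp: field_simps power_numeral_reduce)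

lemma sum_dent_polynomial:
  fixes D e :: real
  shows "(\<Sum>a\<in>{1..<Suc k}. (4 * D * real a * e^2 + 4 * D * e^3 + 2 * D^2 * e^2
      - 4 * real a^2 * e^2 + e^4 + 12 * D * real a * e + 18 * D * e^2 + 6 * D^2 * e
      - 12 * real a^2 * e + 6 * e^3 + 8 * D * real a + 26 * D * e + 4 * D^2 - 8 * real a^2
      + 15 * e^2 + 12 * D + 18 * e + 8) / 8)
    = (6 * D * e^2 * real k^2 + 12 * D * e^3 * real k + 6 * D^2 * e^2 * real k
        - 4 * e^2 * real k^3 + 3 * e^4 * real k + 18 * D * e * real k^2 + 60 * D * e^2 * real k
        + 18 * D^2 * e * real k - 12 * e * real k^3 - 6 * e^2 * real k^2 + 18 * e^3 * real k
        + 96 * D * e * real k + 12 * D * real k^2 + 12 * D^2 * real k - 18 * e * real k^2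
        + 43 * e^2 * real k - 8 * real k^3 + 48 * D * real k + 48 * e * real k - 12 * real k^2
        + 20 * real k) / 24"
  by (induction k) (auto simp: field_simps power_numeral_reduce)

lemma sum_ring_polynomial:
  fixes D r :: real
  shows "(\<Sum>e\<le>k. (225 * D * real e^4 * r - 225 * D * real e^5 + 900 * D^2 * real e^3 * r
      - 900 * D^2 * real e^4 + 600 * D^3 * real e^2 * r - 600 * D^3 * real e^3
      + 90 * D^4 * real e * r - 90 * D^4 * real e^2 - 9 * D^5 * real e + 9 * D^5 * r
      + 1350 * D * real e^3 * r - 1350 * D * real e^4 + 4050 * D^2 * real e^2 * r
      - 4050 * D^2 * real e^3 + 1800 * D^3 * real e * r - 1800 * D^3 * real e^2
      - 135 * D^4 * real e + 135 * D^4 * r + 3225 * D * real e^2 * r - 3405 * D * real e^3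
      + 5760 * D^2 * real e * r - 5850 * D^2 * real e^2 - 1245 * D^3 * real e + 1245 * D^3 * r
      - 45 * real e^4 + 3600 * D * real e * r - 4410 * D * real e^2 - 2835 * D^2 * real e
      + 2565 * D^2 * r - 270 * real e^3 - 2616 * D * real e + 1446 * D * r - 180 * D^2
      - 675 * real e^2 - 540 * D - 810 * real e - 360) / 20)
    = (90 * D * real k^5 * r - 75 * D * real k^6 + 450 * D^2 * real k^4 * r
        - 360 * D^2 * real k^5 + 400 * D^3 * real k^3 * r - 300 * D^3 * real k^4
        + 90 * D^4 * real k^2 * r - 60 * D^4 * real k^3 + 18 * D^5 * real k * r
        - 9 * D^5 * real k^2 + 900 * D * real k^4 * r - 765 * D * real k^5
        + 3600 * D^2 * real k^3 * r - 2925 * D^2 * real k^4 + 2400 * D^3 * real k^2 * r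
        - 1800 * D^3 * real k^3 + 360 * D^4 * real k * r - 225 * D^4 * real k^2
        - 9 * D^5 * real k + 18 * D^5 * r + 3650 * D * real k^3 * r - 3240 * D * real k^4
        + 10260 * D^2 * real k^2 * r - 8550 * D^2 * real k^3 + 4490 * D^3 * real k * r
        - 3345 * D^3 * real k^2 - 165 * D^4 * real k + 270 * D^4 * r - 18 * real k^5
        + 7500 * D * real k^2 * r - 7245 * D * real k^3 + 12240 * D^2 * real k * r
        - 10710 * D^2 * real k^2 - 1845 * D^3 * real k + 2490 * D^3 * r - 180 * real k^4
        + 7552 * D * real k * r - 8691 * D * real k^2 - 5085 * D^2 * real k + 5130 * D^2 * r
        - 750 * real k^3 - 5076 * D * real k + 2892 * D * r - 360 * D^2 - 1620 * real k^2
        - 1080 * D - 1752 * real k - 720) / 40"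
  by (induction k) (auto simp: field_simps power_numeral_reduce)

lemma sum_rings_polynomial:
  fixes s :: real
  shows "(\<Sum>D\<in>{1..k}. (15 * real D * s^6 - 90 * real D^2 * s^5 + 100 * real D^3 * s^4
      + 430 * real D^4 * s^3 - 1368 * real D^5 * s^2 + 1432 * real D^6 * s - 512 * real D^7
      + 135 * real D * s^5 - 675 * real D^2 * s^4 + 600 * real D^3 * s^3 + 1965 * real D^4 * s^2
      - 4248 * real D^5 * s + 2316 * real D^6 + 725 * real D * s^4 - 2830 * real D^2 * s^3
      + 2630 * real D^3 * s^2 + 1875 * real D^4 * s - 2648 * real D^5 - 18 * s^5
      + 2325 * real D * s^3 - 6510 * real D^2 * s^2 + 4290 * real D^3 * s + 1110 * real D^4
      - 135 * s^4 + 4558 * real D * s^2 - 8557 * real D^2 * s + 3472 * real D^3 - 480 * s^3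
      + 4998 * real D * s - 4866 * real D^2 - 945 * s^2 + 2208 * real D - 942 * s - 360) / 40)
    = (105 * real k^2 * s^6 - 420 * real k^3 * s^5 + 350 * real k^4 * s^4 + 1204 * real k^5 * s^3
        - 3192 * real k^6 * s^2 + 2864 * real k^7 * s - 896 * real k^8 + 105 * real k * s^6
        + 315 * real k^2 * s^5 - 2450 * real k^3 * s^4 + 5110 * real k^4 * s^3
        - 4074 * real k^5 * s^2 + 112 * real k^6 * s + 1048 * real k^7 + 483 * real k * s^5
        + 700 * real k^2 * s^4 - 7000 * real k^3 * s^3 + 14980 * real k^4 * s^2
        - 14462 * real k^5 * s + 5852 * real k^6 + 1610 * real k * s^4 - 1435 * real k^2 * s^3
        - 2800 * real k^3 * s^2 + 3360 * real k^4 * s + 784 * real k^5 + 2751 * real k * s^3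
        - 2863 * real k^2 * s^2 - 4494 * real k^3 * s + 6566 * real k^4 + 2569 * real k * s^2
        - 4942 * real k^2 * s + 1372 * real k^3 + 1434 * real k * s - 3962 * real k^2
        - 684 * real k) / 560"
  by (induction k) (auto simp: field_simps power_numeral_reduce)

lemma sum_center_polynomial:
  fixes s :: real
  shows "(\<Sum>e\<le>k. (15 * real e^4 * s - 15 * real e^5 + 90 * real e^3 * s - 99 * real e^4
      + 225 * real e^2 * s - 279 * real e^3 + 270 * real e * s - 405 * real e^2 - 282 * real e
      + 120 * s - 72) / 8)
    = (30 * real k^5 * s - 25 * real k^6 + 300 * real k^4 * s - 273 * real k^5
        + 1250 * real k^3 * s - 1255 * real k^4 + 2700 * real k^2 * s - 3075 * real k^3
        + 2920 * real k * s - 4120 * real k^2 - 2772 * real k + 1200 * s - 720) / 80"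
  by (induction k) (auto simp: field_simps power_numeral_reduce)

section \<open>Evaluation of the ring sums\<close>

lemma sum_peak_count:
  assumes "1 \<le> D"
  shows "(\<Sum>a\<in>{1..<D}. peak_count (int (D + e)) (int a) (int D - int a))
      = (15 * real D * real e^4 + 60 * real D^2 * real e^3 + 40 * real D^3 * real e^2
      + 10 * real D^4 * real e + real D^5 + 30 * real D * real e^3 + 240 * real D^2 * real e^2
      + 120 * real D^3 * real e + 15 * real D^4 - 15 * real e^4 - 55 * real D * real e^2
      + 290 * real D^2 * real e + 85 * real D^3 - 90 * real e^3 - 150 * real D * real e
      + 105 * real D^2 - 225 * real e^2 - 86 * real D - 270 * real e - 120) / 120"
proof -
  obtain k where D: "D = Suc k" using assms by (cases D) auto
  have "(\<Sum>a\<in>{1..<D}. peak_count (int (D + e)) (int a) (int D - int a))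
      = (\<Sum>a\<in>{1..<D}. (4 * real D * real a * real e^2 - 4 * real D * real a^2 * real e
      - 4 * real D * real a^3 + 4 * real D * real e^3 + 4 * real D^2 * real a * real e
      + 2 * real D^2 * real a^2 + 2 * real D^2 * real e^2 - 4 * real a^2 * real e^2
      + 2 * real a^4 + real e^4 + 12 * real D * real a * real e - 6 * real D * real a^2
      + 18 * real D * real e^2 + 6 * real D^2 * real a + 6 * real D^2 * real e
      - 12 * real a^2 * real e + 6 * real e^3 + 10 * real D * real a + 26 * real D * real e
      + 4 * real D^2 - 10 * real a^2 + 15 * real e^2 + 12 * real D + 18 * real e + 8) / 8)"
    by (rule sum.cong[OF refl], subst peak_count_poly)
        (auto simp: binom4_def field_simps power_numeral_reduce)
  also have "\<dots> = (15 * real D * real e^4 + 60 * real D^2 * real e^3 + 40 * real D^3 * real e^2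
      + 10 * real D^4 * real e + real D^5 + 30 * real D * real e^3 + 240 * real D^2 * real e^2
      + 120 * real D^3 * real e + 15 * real D^4 - 15 * real e^4 - 55 * real D * real e^2
      + 290 * real D^2 * real e + 85 * real D^3 - 90 * real e^3 - 150 * real D * real e
      + 105 * real D^2 - 225 * real e^2 - 86 * real D - 270 * real e - 120) / 120"
    unfolding D sum_peak_polynomial by (simp add: field_simps power_numeral_reduce)
  finally show ?thesis .
qed

lemma sum_dent_count:
  assumes "1 \<le> D"
  shows "(\<Sum>a\<in>{1..<D}. dent_count (int (D + e)) (int a) (int D - int a))
      = (3 * real D * real e^4 + 12 * real D^2 * real e^3 + 8 * real D^3 * real e^2
      + 6 * real D * real e^3 + 48 * real D^2 * real e^2 + 24 * real D^3 * real e - 3 * real e^4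
      - 11 * real D * real e^2 + 60 * real D^2 * real e + 16 * real D^3 - 18 * real e^3
      - 30 * real D * real e + 24 * real D^2 - 45 * real e^2 - 16 * real D - 54 * real e - 24) / 24"
proof -
  obtain k where D: "D = Suc k" using assms by (cases D) auto
  have "(\<Sum>a\<in>{1..<D}. dent_count (int (D + e)) (int a) (int D - int a))
      = (\<Sum>a\<in>{1..<D}. (4 * real D * real a * real e^2 + 4 * real D * real e^3
      + 2 * real D^2 * real e^2 - 4 * real a^2 * real e^2 + real e^4
      + 12 * real D * real a * real e + 18 * real D * real e^2 + 6 * real D^2 * real e
      - 12 * real a^2 * real e + 6 * real e^3 + 8 * real D * real a + 26 * real D * real e
      + 4 * real D^2 - 8 * real a^2 + 15 * real e^2 + 12 * real D + 18 * real e + 8) / 8)"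
    by (rule sum.cong[OF refl], subst dent_count_poly)
        (auto simp: binom3_def binom4_def field_simps power_numeral_reduce)
  also have "\<dots> = (3 * real D * real e^4 + 12 * real D^2 * real e^3 + 8 * real D^3 * real e^2
      + 6 * real D * real e^3 + 48 * real D^2 * real e^2 + 24 * real D^3 * real e - 3 * real e^4
      - 11 * real D * real e^2 + 60 * real D^2 * real e + 16 * real D^3 - 18 * real e^3
      - 30 * real D * real e + 24 * real D^2 - 45 * real e^2 - 16 * real D - 54 * real e - 24) / 24"
    unfolding D sum_dent_polynomial by (simp add: field_simps power_numeral_reduce)
  finally show ?thesis .
qed

lemma peak_count_axis: "peak_count (int (D + e)) (int D) 0
    = (4 * real D * real e^3 + 2 * real D^2 * real e^2 + real e^4 + 18 * real D * real e^2
    + 6 * real D^2 * real e + 6 * real e^3 + 26 * real D * real e + 4 * real D^2 + 15 * real e^2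
    + 12 * real D + 18 * real e + 8) / 8"
  by (subst peak_count_poly) (auto simp: binom4_def field_simps power_numeral_reduce)

lemma ring_sum_inner:
  assumes "1 \<le> D"
  shows "ring_sum D (D + e) n = 6 * axis_weight n
      * ((4 * real D * real e^3 + 2 * real D^2 * real e^2 + real e^4 + 18 * real D * real e^2
      + 6 * real D^2 * real e + 6 * real e^3 + 26 * real D * real e + 4 * real D^2
      + 15 * real e^2 + 12 * real D + 18 * real e + 8) / 8)
    + 3 * peak_weight n * ((3 * real D * real e^4 + 12 * real D^2 * real e^3
        + 8 * real D^3 * real e^2 + 6 * real D * real e^3 + 48 * real D^2 * real e^2
        + 24 * real D^3 * real e - 3 * real e^4 - 11 * real D * real e^2 + 60 * real D^2 * real e
        + 16 * real D^3 - 18 * real e^3 - 30 * real D * real e + 24 * real D^2 - 45 * real e^2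
        - 16 * real D - 54 * real e - 24) / 24)
    + 3 * dent_weight n * ((15 * real D * real e^4 + 60 * real D^2 * real e^3
        + 40 * real D^3 * real e^2 + 10 * real D^4 * real e + real D^5 + 30 * real D * real e^3
        + 240 * real D^2 * real e^2 + 120 * real D^3 * real e + 15 * real D^4 - 15 * real e^4
        - 55 * real D * real e^2 + 290 * real D^2 * real e + 85 * real D^3 - 90 * real e^3
        - 150 * real D * real e + 105 * real D^2 - 225 * real e^2 - 86 * real D - 270 * real e
        - 120) / 120)"
proof -
  have "ring_sum D (D + e) n = 6 * axis_weight n * peak_count (int (D + e)) (int D) 0
      + 3 * peak_weight n * (\<Sum>a\<in>{1..<D}. dent_count (int (D + e)) (int a) (int D - int a))
      + 3 * dent_weight n * (\<Sum>a\<in>{1..<D}. peak_count (int (D + e)) (int a) (int D - int a))"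
    unfolding ring_sum_def sum.distrib sum_distrib_left[symmetric] by (simp add: distrib_left)
  then show ?thesis
    unfolding peak_count_axis sum_peak_count[OF assms] sum_dent_count[OF assms] .
qed

lemma sum_ring_inner:
  assumes "1 \<le> D"
  shows "(\<Sum>e\<le>r. ring_sum D (D + e) (r - e))
      = (15 * real D * real r^6 + 90 * real D^2 * real r^5 + 100 * real D^3 * real r^4
      + 30 * real D^4 * real r^3 + 9 * real D^5 * real r^2 + 135 * real D * real r^5
      + 675 * real D^2 * real r^4 + 600 * real D^3 * real r^3 + 135 * real D^4 * real r^2
      + 9 * real D^5 * real r + 545 * real D * real r^4 + 2250 * real D^2 * real r^3
      + 1505 * real D^3 * real r^2 + 165 * real D^4 * real r + 6 * real D^5 - 18 * real r^5
      + 1245 * real D * real r^3 + 4050 * real D^2 * real r^2 + 1725 * real D^3 * real r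
      + 90 * real D^4 - 135 * real r^4 + 1606 * real D * real r^2 + 3765 * real D^2 * real r
      + 750 * real D^3 - 480 * real r^3 + 1146 * real D * real r + 1350 * real D^2
      - 945 * real r^2 + 324 * real D - 942 * real r - 360) / 40"
proof -
  \<comment> \<open>The weights leave their linear form only at argument 0, that is at
    \<open>e = r\<close>. Isolating this as one \<open>if\<close> term leaves a sum of
    polynomials.\<close>
  have "(\<Sum>e\<le>r. ring_sum D (D + e) (r - e))
      = (\<Sum>e\<le>r. (225 * real D * real e^4 * real r - 225 * real D * real e^5
      + 900 * real D^2 * real e^3 * real r - 900 * real D^2 * real e^4
      + 600 * real D^3 * real e^2 * real r - 600 * real D^3 * real e^3
      + 90 * real D^4 * real e * real r - 90 * real D^4 * real e^2 - 9 * real D^5 * real e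
      + 9 * real D^5 * real r + 1350 * real D * real e^3 * real r - 1350 * real D * real e^4
      + 4050 * real D^2 * real e^2 * real r - 4050 * real D^2 * real e^3
      + 1800 * real D^3 * real e * real r - 1800 * real D^3 * real e^2 - 135 * real D^4 * real e
      + 135 * real D^4 * real r + 3225 * real D * real e^2 * real r - 3405 * real D * real e^3
      + 5760 * real D^2 * real e * real r - 5850 * real D^2 * real e^2 - 1245 * real D^3 * real e
      + 1245 * real D^3 * real r - 45 * real e^4 + 3600 * real D * real e * real r
      - 4410 * real D * real e^2 - 2835 * real D^2 * real e + 2565 * real D^2 * real r
      - 270 * real e^3 - 2616 * real D * real e + 1446 * real D * real r - 180 * real D^2
      - 675 * real e^2 - 540 * real D - 810 * real e - 360) / 20
      + (if e = r then (135 * real D * real e^4 + 540 * real D^2 * real e^3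
          + 360 * real D^3 * real e^2 + 60 * real D^4 * real e + 6 * real D^5
          + 990 * real D * real e^3 + 2520 * real D^2 * real e^2 + 1080 * real D^3 * real e
          + 90 * real D^4 + 45 * real e^4 + 2745 * real D * real e^2 + 3720 * real D^2 * real e
          + 750 * real D^3 + 270 * real e^3 + 3330 * real D * real e + 1710 * real D^2
          + 675 * real e^2 + 1404 * real D + 810 * real e + 360) / 40 else 0))"
  proof (rule sum.cong[OF refl])
    fix e assume "e \<in> {..r}"
    then have e: "e \<le> r" by simp
    show "ring_sum D (D + e) (r - e)
        = (225 * real D * real e^4 * real r - 225 * real D * real e^5
        + 900 * real D^2 * real e^3 * real r - 900 * real D^2 * real e^4
        + 600 * real D^3 * real e^2 * real r - 600 * real D^3 * real e^3
        + 90 * real D^4 * real e * real r - 90 * real D^4 * real e^2 - 9 * real D^5 * real e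
        + 9 * real D^5 * real r + 1350 * real D * real e^3 * real r - 1350 * real D * real e^4
        + 4050 * real D^2 * real e^2 * real r - 4050 * real D^2 * real e^3
        + 1800 * real D^3 * real e * real r - 1800 * real D^3 * real e^2
        - 135 * real D^4 * real e + 135 * real D^4 * real r + 3225 * real D * real e^2 * real r
        - 3405 * real D * real e^3 + 5760 * real D^2 * real e * real r
        - 5850 * real D^2 * real e^2 - 1245 * real D^3 * real e + 1245 * real D^3 * real r
        - 45 * real e^4 + 3600 * real D * real e * real r - 4410 * real D * real e^2
        - 2835 * real D^2 * real e + 2565 * real D^2 * real r - 270 * real e^3
        - 2616 * real D * real e + 1446 * real D * real r - 180 * real D^2 - 675 * real e^2
        - 540 * real D - 810 * real e - 360) / 20
      + (if e = r then (135 * real D * real e^4 + 540 * real D^2 * real e^3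
          + 360 * real D^3 * real e^2 + 60 * real D^4 * real e + 6 * real D^5
          + 990 * real D * real e^3 + 2520 * real D^2 * real e^2 + 1080 * real D^3 * real e
          + 90 * real D^4 + 45 * real e^4 + 2745 * real D * real e^2 + 3720 * real D^2 * real e
          + 750 * real D^3 + 270 * real e^3 + 3330 * real D * real e + 1710 * real D^2
          + 675 * real e^2 + 1404 * real D + 810 * real e + 360) / 40 else 0)"
      unfolding ring_sum_inner[OF assms] using e
      by (simp add: axis_weight_def peak_weight_def dent_weight_def of_nat_diff)
          (auto simp: field_simps power_numeral_reduce)
  qed
  also have "\<dots> = (15 * real D * real r^6 + 90 * real D^2 * real r^5 + 100 * real D^3 * real r^4
      + 30 * real D^4 * real r^3 + 9 * real D^5 * real r^2 + 135 * real D * real r^5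
      + 675 * real D^2 * real r^4 + 600 * real D^3 * real r^3 + 135 * real D^4 * real r^2
      + 9 * real D^5 * real r + 545 * real D * real r^4 + 2250 * real D^2 * real r^3
      + 1505 * real D^3 * real r^2 + 165 * real D^4 * real r + 6 * real D^5 - 18 * real r^5
      + 1245 * real D * real r^3 + 4050 * real D^2 * real r^2 + 1725 * real D^3 * real r
      + 90 * real D^4 - 135 * real r^4 + 1606 * real D * real r^2 + 3765 * real D^2 * real r
      + 750 * real D^3 - 480 * real r^3 + 1146 * real D * real r + 1350 * real D^2
      - 945 * real r^2 + 324 * real D - 942 * real r - 360) / 40"
    unfolding sum.distrib sum_ring_polynomial by (simp add: field_simps power_numeral_reduce)
  finally show ?thesis .
qed

lemma sum_center: "(\<Sum>m\<le>s. center_weight m * peak_count (int (s - m)) 0 0)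
    = (5 * real s^6 + 27 * real s^5 + 95 * real s^4 + 225 * real s^3 + 300 * real s^2
    + 228 * real s + 80) / 80"
proof -
  have "(\<Sum>m\<le>s. center_weight m * peak_count (int (s - m)) 0 0)
      = (\<Sum>e\<le>s. center_weight (s - e) * peak_count (int e) 0 0)"
    by (rule sum.reindex_bij_witness[of _ "\<lambda>e. s - e" "\<lambda>m. s - m"]) auto
  also have "\<dots> = (\<Sum>e\<le>s. (15 * real e^4 * real s - 15 * real e^5 + 90 * real e^3 * real s
      - 99 * real e^4 + 225 * real e^2 * real s - 279 * real e^3 + 270 * real e * real s
      - 405 * real e^2 - 282 * real e + 120 * real s - 72) / 8
      + (if e = s then (5 * real e^4 + 30 * real e^3 + 75 * real e^2 + 90 * real e + 40) / 4 else
      0))"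
  proof (rule sum.cong[OF refl])
    fix e assume "e \<in> {..s}"
    then have e: "e \<le> s" by simp
    have peak_count: "peak_count (int e) 0 0
        = (real e^4 + 6 * real e^3 + 15 * real e^2 + 18 * real e + 8) / 8"
      by (subst peak_count_poly) (auto simp: binom4_def field_simps power_numeral_reduce)
    show "center_weight (s - e) * peak_count (int e) 0 0
        = (15 * real e^4 * real s - 15 * real e^5 + 90 * real e^3 * real s - 99 * real e^4
        + 225 * real e^2 * real s - 279 * real e^3 + 270 * real e * real s - 405 * real e^2
        - 282 * real e + 120 * real s - 72) / 8
        + (if e = s then (5 * real e^4 + 30 * real e^3 + 75 * real e^2 + 90 * real e + 40) / 4
        else 0)"
      unfolding peak_count using e by (simp add: center_weight_def of_nat_diff)
          (auto simp: field_simps power_numeral_reduce)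
  qed
  also have "\<dots> = (5 * real s^6 + 27 * real s^5 + 95 * real s^4 + 225 * real s^3 + 300 * real s^2
      + 228 * real s + 80) / 80"
    unfolding sum.distrib sum_center_polynomial by (simp add: field_simps power_numeral_reduce)
  finally show ?thesis .
qed

text \<open>All dependence on residues is now in \<open>s div 2\<close>; substituting
  \<open>2 * k\<close> or \<open>2 * k + 1\<close> for \<open>s\<close> turns the claim into a
  polynomial identity in \<open>k\<close>.\<close>

lemma SH33_quasi_polynomial:
  "real (SH33 s) = (5 * real s^6 + 27 * real s^5 + 95 * real s^4 + 225 * real s^3
      + 300 * real s^2 + 228 * real s + 80) / 80
      + (105 * real (s div 2)^2 * real s^6 - 420 * real (s div 2)^3 * real s^5
      + 350 * real (s div 2)^4 * real s^4 + 1204 * real (s div 2)^5 * real s^3 - 3192 * real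
      (s div 2)^6 * real s^2 + 2864 * real (s div 2)^7 * real s - 896 * real (s div 2)^8
      + 105 * real (s div 2) * real s^6 + 315 * real (s div 2)^2 * real s^5 - 2450 * real
      (s div 2)^3 * real s^4 + 5110 * real (s div 2)^4 * real s^3 - 4074 * real
      (s div 2)^5 * real s^2 + 112 * real (s div 2)^6 * real s + 1048 * real (s div 2)^7
      + 483 * real (s div 2) * real s^5 + 700 * real (s div 2)^2 * real s^4 - 7000 * real
      (s div 2)^3 * real s^3 + 14980 * real (s div 2)^4 * real s^2 - 14462 * real
      (s div 2)^5 * real s + 5852 * real (s div 2)^6 + 1610 * real (s div 2) * real s^4
      - 1435 * real (s div 2)^2 * real s^3 - 2800 * real (s div 2)^3 * real s^2 + 3360 * real
      (s div 2)^4 * real s + 784 * real (s div 2)^5 + 2751 * real (s div 2) * real s^3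
      - 2863 * real (s div 2)^2 * real s^2 - 4494 * real (s div 2)^3 * real s + 6566 * real
      (s div 2)^4 + 2569 * real (s div 2) * real s^2 - 4942 * real (s div 2)^2 * real s
      + 1372 * real (s div 2)^3 + 1434 * real (s div 2) * real s - 3962 * real (s div 2)^2
      - 684 * real (s div 2)) / 560"
proof -
  have "(\<Sum>D\<in>{1..s div 2}. 9 * (real (s - 2 * D)) * (real (s - 2 * D) + 1) * binom5 (real D + 4)
         + (\<Sum>e\<le>s - 2 * D. ring_sum D (D + e) (s - 2 * D - e)))
      = (\<Sum>D\<in>{1..s div 2}. (15 * real D * real s^6 - 90 * real D^2 * real s^5
          + 100 * real D^3 * real s^4 + 430 * real D^4 * real s^3 - 1368 * real D^5 * real s^2
          + 1432 * real D^6 * real s - 512 * real D^7 + 135 * real D * real s^5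
          - 675 * real D^2 * real s^4 + 600 * real D^3 * real s^3 + 1965 * real D^4 * real s^2
          - 4248 * real D^5 * real s + 2316 * real D^6 + 725 * real D * real s^4
          - 2830 * real D^2 * real s^3 + 2630 * real D^3 * real s^2 + 1875 * real D^4 * real s
          - 2648 * real D^5 - 18 * real s^5 + 2325 * real D * real s^3
          - 6510 * real D^2 * real s^2 + 4290 * real D^3 * real s + 1110 * real D^4
          - 135 * real s^4 + 4558 * real D * real s^2 - 8557 * real D^2 * real s
          + 3472 * real D^3 - 480 * real s^3 + 4998 * real D * real s - 4866 * real D^2
          - 945 * real s^2 + 2208 * real D - 942 * real s - 360) / 40)"
  proof (rule sum.cong[OF refl])
    fix D assume "D \<in> {1..s div 2}"
    then have D: "1 \<le> D" "2 * D \<le> s" by auto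
    \<comment> \<open>Expressing \<open>s\<close> as \<open>r + 2 * D\<close> removes the truncated
      subtraction before the polynomials in \<open>s\<close> and \<open>D\<close> are
      compared.\<close>
    define r where "r = s - 2 * D"
    have r: "s - 2 * D = r" "real s = real r + 2 * real D"
      using D by (simp_all add: r_def of_nat_diff)
    show "9 * (real (s - 2 * D)) * (real (s - 2 * D) + 1) * binom5 (real D + 4)
         + (\<Sum>e\<le>s - 2 * D. ring_sum D (D + e) (s - 2 * D - e))
             = (15 * real D * real s^6 - 90 * real D^2 * real s^5 + 100 * real D^3 * real s^4
             + 430 * real D^4 * real s^3 - 1368 * real D^5 * real s^2 + 1432 * real D^6 * real s
             - 512 * real D^7 + 135 * real D * real s^5 - 675 * real D^2 * real s^4
             + 600 * real D^3 * real s^3 + 1965 * real D^4 * real s^2 - 4248 * real D^5 * real s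
             + 2316 * real D^6 + 725 * real D * real s^4 - 2830 * real D^2 * real s^3
             + 2630 * real D^3 * real s^2 + 1875 * real D^4 * real s - 2648 * real D^5
             - 18 * real s^5 + 2325 * real D * real s^3 - 6510 * real D^2 * real s^2
             + 4290 * real D^3 * real s + 1110 * real D^4 - 135 * real s^4
             + 4558 * real D * real s^2 - 8557 * real D^2 * real s + 3472 * real D^3
             - 480 * real s^3 + 4998 * real D * real s - 4866 * real D^2 - 945 * real s^2
             + 2208 * real D - 942 * real s - 360) / 40"
      unfolding r sum_ring_inner[OF D(1)]
      by (simp add: binom5_def field_simps power_numeral_reduce)
  qed
  then show ?thesis
    unfolding SH33_sum_rings sum_center sum_rings_polynomial by simp
qed

theorem theorem2p0p3:
  fixes s :: nat
  shows "real (SH33 s) =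
    (if 2 dvd s then
       9/2240 * real s ^ 8 + 27/560 * real s ^ 7 + 87/320 * real s ^ 6 + 297/320 * real s ^ 5
         + 1341/640 * real s ^ 4 + 513/160 * real s ^ 3 + 3653/1120 * real s ^ 2
         + 627/280 * real s + 1
     else
       9/2240 * real s ^ 8 + 27/560 * real s ^ 7 + 87/320 * real s ^ 6 + 297/320 * real s ^ 5
         + 1341/640 * real s ^ 4 + 513/160 * real s ^ 3 + 3653/1120 * real s ^ 2
         + 4071/2240 * real s + 47/128)"
proof (cases "2 dvd s")
  case True
  then obtain k where "s = 2 * k" by (rule dvdE)
  then show ?thesis unfolding SH33_quasi_polynomial
    by (simp add: field_simps power_numeral_reduce)
next
  case False
  then obtain k where "s = 2 * k + 1" by (rule oddE)
  then show ?thesis unfolding SH33_quasi_polynomial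
    by (simp add: field_simps power_numeral_reduce)
qed

end
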